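(* Let $A$ and $B$ be connected, vertex-transitive, locally finite graphs with at least two vertices each. Then the wreath product of graphs $B\wr A$ has linear divergence.
   Context: **Wreath product of graphs.** Fix a vertex $b_0$ of $B$. For a function $f$ from the vertex set of $A$ to the vertex set of $B$, its support is $\{a\in A\mid f(a)\neq b_0\}$. The vertices of $B\wr A$ are the pairs $(f,a)$, where $a$ is a vertex of $A$ and $f:A\to B$ has finite support. There are two types of edges: type (1) edges connect $(f_1,a_1)$ and $(f_2,a_2)$ if $a_1=a_2$, $f_1(x)=f_2(x)$ for all $x\neq a_1$, and $f_1(a_1)$ is adjacent to $f_2(a_1)$ in $B$; type (2) edges connect $(f_1,a_1)$ and $(f_2,a_2)$ if $f_1=f_2$ and $a_1$ is adjacent to $a_2$ in $A$. **Divergence.** Let $X$ be a geodesic metric space (connected graphs are viewed as geodesic metric spaces with edges of length $1$), $\delta\in(0,1)$, $\gamma\geq 0$. For $a,b,c\in X$ put $r=\min\{\operatorname{dist}(c,a),\operatorname{dist}(c,b)\}$ and let $\operatorname{div}_\gamma(a,b,c;\delta)$ be the infimum of the lengths of paths connecting $a$ to $b$ in $X\setminus B(c,\delta r-\gamma)$, where $B(\cdot,\cdot)$ denotes the open ball (empty if the radius is non-positive); it is $\infty$ if there is no such path. Put $\operatorname{Div}_\gamma(n,\delta)=\sup\{\operatorname{div}_\gamma(a,b,c;\delta): a,b,c\in X,\ \operatorname{dist}(a,b)\leq n\}$. For functions $f,g$ on $\mathbb R_+$ write $f\preceq g$ if there is $A\geq 1$ with $f(x)\leq A g(Ax+A)+Ax+A$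 for all $x\in\mathbb R_+$, and $f\asymp g$ if $f\preceq g$ and $g\preceq f$. The space $X$ has *linear divergence* if $\operatorname{Div}_\gamma(n,\delta)\asymp n$ for some $\delta\in(0,1)$ and $\gamma\geq 0$. (For one-ended connected locally finite vertex-transitive graphs it is known that $\operatorname{Div}_\gamma(n,\delta)$ does not depend, up to $\asymp$, on $\delta\leq 1/2$ and $\gamma\geq 2$.) *)

theory Defs
  imports "HOL-Analysis.Analysis"
begin

section \<open>Graphs\<close>

text \<open>Simple undirected graphs, possibly infinite; every edge occurs in \<open>edges\<close> in both orientations.\<close>

record 'v sgraph =
  verts :: "'v set"
  edges :: "('v \<times> 'v) set"

definition simple_graph :: "'v sgraph \<Rightarrow> bool" where
  "simple_graph G \<longleftrightarrow> edges G \<subseteq> verts G \<times> verts G \<and> sym (edges G) \<and> irrefl (edges G)"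

definition connected_graph :: "'v sgraph \<Rightarrow> bool" where
  "connected_graph G \<longleftrightarrow> (\<forall>u\<in>verts G. \<forall>v\<in>verts G. (u, v) \<in> (edges G)\<^sup>*)"

definition locally_finite_graph :: "'v sgraph \<Rightarrow> bool" where
  "locally_finite_graph G \<longleftrightarrow> (\<forall>v\<in>verts G. finite {w. (v, w) \<in> edges G})"

definition graph_automorphism :: "'v sgraph \<Rightarrow> ('v \<Rightarrow> 'v) \<Rightarrow> bool" where
  "graph_automorphism G \<phi> \<longleftrightarrow>
     bij_betw \<phi> (verts G) (verts G) \<and>
     (\<forall>u\<in>verts G. \<forall>v\<in>verts G. (\<phi> u, \<phi> v) \<in> edges G \<longleftrightarrow> (u, v) \<in> edges G)"

definition vertex_transitive :: "'v sgraph \<Rightarrow> bool" where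
  "vertex_transitive G \<longleftrightarrow>
     (\<forall>u\<in>verts G. \<forall>v\<in>verts G. \<exists>\<phi>. graph_automorphism G \<phi> \<and> \<phi> u = v)"


section \<open>Wreath products\<close>

text \<open>
  Functions from the vertices of \<open>A\<close> to those of \<open>B\<close> are taken in the extensional function space,
  so that they are determined by their values on \<open>verts A\<close>.
\<close>

definition wreath_verts :: "'b sgraph \<Rightarrow> 'b \<Rightarrow> 'a sgraph \<Rightarrow> (('a \<Rightarrow> 'b) \<times> 'a) set" where
  "wreath_verts B b\<^sub>0 A =
     {(f, a). f \<in> verts A \<rightarrow>\<^sub>E verts B \<and> finite {x \<in> verts A. f x \<noteq> b\<^sub>0} \<and> a \<in> verts A}"

definition wreath :: "'b sgraph \<Rightarrow> 'b \<Rightarrow> 'a sgraph \<Rightarrow> (('a \<Rightarrow> 'b) \<times> 'a) sgraph" where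
  "wreath B b\<^sub>0 A =
     \<lparr> verts = wreath_verts B b\<^sub>0 A,
       edges = {((f\<^sub>1, a\<^sub>1), (f\<^sub>2, a\<^sub>2)).
         (f\<^sub>1, a\<^sub>1) \<in> wreath_verts B b\<^sub>0 A \<and> (f\<^sub>2, a\<^sub>2) \<in> wreath_verts B b\<^sub>0 A \<and>
         (a\<^sub>1 = a\<^sub>2 \<and> (\<forall>x\<in>verts A. x \<noteq> a\<^sub>1 \<longrightarrow> f\<^sub>1 x = f\<^sub>2 x) \<and> (f\<^sub>1 a\<^sub>1, f\<^sub>2 a\<^sub>1) \<in> edges B
          \<or> f\<^sub>1 = f\<^sub>2 \<and> (a\<^sub>1, a\<^sub>2) \<in> edges A)} \<rparr>"

lemma simple_graph_wreath:
  assumes "simple_graph A" "simple_graph B"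
  shows "simple_graph (wreath B b\<^sub>0 A)"
  using assms unfolding simple_graph_def wreath_def
  by (auto simp: sym_def irrefl_def)

lemma connected_graph_wreath:
  assumes A: "simple_graph A" "connected_graph A"
    and B: "simple_graph B" "connected_graph B" and b0: "b\<^sub>0 \<in> verts B"
  shows "connected_graph (wreath B b\<^sub>0 A)"
proof -
  let ?V = "wreath_verts B b\<^sub>0 A" and ?E = "edges (wreath B b\<^sub>0 A)"
  have symE: "sym (?E\<^sup>*)"
    using simple_graph_wreath[OF A(1) B(1)] by (auto simp: simple_graph_def intro: sym_rtrancl)
  have move: "((f, a), (f, c)) \<in> ?E\<^sup>*" if "(f, a) \<in> ?V" "c \<in> verts A" for f a c
  proof -
    have "(a, c) \<in> (edges A)\<^sup>*"
      using A(2) that by (auto simp: connected_graph_def wreath_verts_def)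
    then show ?thesis
    proof (induction rule: rtrancl_induct)
      case (step y z)
      then have "((f, y), (f, z)) \<in> ?E"
        using that A(1) by (auto simp: wreath_def wreath_verts_def simple_graph_def)
      with step.IH show ?case by (rule rtrancl_into_rtrancl)
    qed simp
  qed
  have switch: "((f, a), (f(a := b), a)) \<in> ?E\<^sup>*" if fa: "(f, a) \<in> ?V" and "b \<in> verts B" for f a b
  proof -
    have "(f a, b) \<in> (edges B)\<^sup>*"
      using B(2) that by (auto simp: connected_graph_def wreath_verts_def)
    then show ?thesis
    proof (induction rule: rtrancl_induct)
      case (step y z)
      have V: "(f(a := w), a) \<in> ?V" if "w \<in> verts B" for w
      proof -
        have "finite {x \<in> verts A. (f(a := w)) x \<noteq> b\<^sub>0}"
          by (rule finite_subset[of _ "insert a {x \<in> verts A. f x \<noteq> b\<^sub>0}"])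
             (use fa in \<open>auto simp: wreath_verts_def\<close>)
        then show ?thesis
          using fa that by (auto simp: wreath_verts_def PiE_iff extensional_def)
      qed
      have "((f(a := y), a), (f(a := z), a)) \<in> ?E"
        using step.hyps(2) V[of y] V[of z] B(1) by (auto simp: wreath_def simple_graph_def)
      with step.IH show ?case by (rule rtrancl_into_rtrancl)
    qed simp
  qed
  have base: "((f, a), (restrict (\<lambda>_. b\<^sub>0) (verts A), c)) \<in> ?E\<^sup>*"
    if "(f, a) \<in> ?V" "c \<in> verts A" for f a c
    using that
  proof (induction "card {x \<in> verts A. f x \<noteq> b\<^sub>0}" arbitrary: f a)
    case 0
    then have "f x = b\<^sub>0" if "x \<in> verts A" for x
      using that by (auto simp: wreath_verts_def)
    then have "f = restrict (\<lambda>_. b\<^sub>0) (verts A)"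
      using 0 by (intro extensionalityI[of _ "verts A"]) (auto simp: wreath_verts_def PiE_iff)
    then show ?case using move[OF 0(2,3)] by simp
  next
    case (Suc n)
    then obtain x where x: "x \<in> verts A" "f x \<noteq> b\<^sub>0"
      by (cases "{x \<in> verts A. f x \<noteq> b\<^sub>0} = {}") auto
    let ?S = "{x \<in> verts A. f x \<noteq> b\<^sub>0}"
    let ?g = "f(x := b\<^sub>0)"
    have S: "{y \<in> verts A. ?g y \<noteq> b\<^sub>0} = ?S - {x}" by auto
    have fin: "finite ?S" using Suc.prems by (auto simp: wreath_verts_def)
    have g: "(?g, x) \<in> ?V"
      using Suc.prems x b0 fin unfolding wreath_verts_def mem_Collect_eq prod.case S
      by (auto simp: PiE_iff extensional_def)
    have fx: "(f, x) \<in> ?V" using Suc.prems x by (auto simp: wreath_verts_def)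
    have "n = card {y \<in> verts A. ?g y \<noteq> b\<^sub>0}"
      unfolding S using Suc.hyps(2) x fin by (simp add: card_Diff_singleton_if)
    then have 3: "((?g, x), (restrict (\<lambda>_. b\<^sub>0) (verts A), c)) \<in> ?E\<^sup>*"
      using Suc.hyps(1) g Suc.prems by blast
    have 1: "((f, a), (f, x)) \<in> ?E\<^sup>*" using move Suc.prems x by blast
    have 2: "((f, x), (?g, x)) \<in> ?E\<^sup>*" using switch fx b0 by blast
    show ?case by (rule rtrancl_trans[OF rtrancl_trans[OF 1 2] 3])
  qed
  show ?thesis
    unfolding connected_graph_def
  proof (intro ballI)
    fix p q assume "p \<in> verts (wreath B b\<^sub>0 A)" "q \<in> verts (wreath B b\<^sub>0 A)"
    then obtain f a g c where pq: "p = (f, a)" "(f, a) \<in> ?V" "q = (g, c)" "(g, c) \<in> ?V"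
      by (cases p, cases q) (auto simp: wreath_def)
    then have "c \<in> verts A" by (auto simp: wreath_verts_def)
    then show "(p, q) \<in> ?E\<^sup>*"
      using rtrancl_trans[OF base symD[OF symE base], of f a c g c] pq by simp
  qed
qed


section \<open>Graphs as metric spaces\<close>

text \<open>
  A point of the geometric realization is given by its barycentric coordinates:
  \<open>edge_point u v t\<close> is the point at distance \<open>t\<close> from \<open>u\<close> on the edge from \<open>u\<close> to \<open>v\<close>.
\<close>

definition edge_point :: "'v \<Rightarrow> 'v \<Rightarrow> real \<Rightarrow> 'v \<Rightarrow> real" where
  "edge_point u v t = (\<lambda>x. (1 - t) * indicator {u} x + t * indicator {v} x)"

definition vertex_point :: "'v \<Rightarrow> 'v \<Rightarrow> real" where
  "vertex_point v = indicator {v}"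

definition realization_points :: "'v sgraph \<Rightarrow> ('v \<Rightarrow> real) set" where
  "realization_points G =
     vertex_point ` verts G \<union> {edge_point u v t | u v t. (u, v) \<in> edges G \<and> t \<in> {0..1}}"

text \<open>
  \<open>pl_chain G p l q\<close>: there is a piecewise linear path of length \<open>l\<close> from \<open>p\<close> to \<open>q\<close>, that is,
  a finite concatenation of segments, each contained in a single closed edge of length 1.
  The distance of two points is the infimum of the lengths of such paths.
\<close>

inductive pl_chain :: "'v sgraph \<Rightarrow> ('v \<Rightarrow> real) \<Rightarrow> real \<Rightarrow> ('v \<Rightarrow> real) \<Rightarrow> bool" for G where
  refl: "p \<in> realization_points G \<Longrightarrow> pl_chain G p 0 p"
| step: "pl_chain G p l (edge_point u v s) \<Longrightarrow> (u, v) \<in> edges G \<Longrightarrow> s \<in> {0..1} \<Longrightarrow> t \<in> {0..1}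
           \<Longrightarrow> pl_chain G p (l + \<bar>s - t\<bar>) (edge_point u v t)"

definition realization_dist :: "'v sgraph \<Rightarrow> ('v \<Rightarrow> real) \<Rightarrow> ('v \<Rightarrow> real) \<Rightarrow> real" where
  "realization_dist G p q =
     (if p \<in> realization_points G \<and> q \<in> realization_points G
      then Inf {l. pl_chain G p l q} else 0)"

text \<open>
  The type \<open>metric\<close> requires a proof that this is a metric, which is
  \<open>Metric_space_realization\<close> below; it needs \<open>G\<close> to be connected.
\<close>

definition realization :: "'v sgraph \<Rightarrow> ('v \<Rightarrow> real) metric" where
  "realization G = metric (realization_points G, realization_dist G)"

lemma edge_point_0: "edge_point u v 0 = vertex_point u"
  and edge_point_1: "edge_point u v 1 = vertex_point v"
  by (auto simp: edge_point_def vertex_point_def)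

lemma pl_chain_points:
  "pl_chain G p l q \<Longrightarrow> p \<in> realization_points G \<and> q \<in> realization_points G"
  by (induction rule: pl_chain.induct) (auto simp: realization_points_def)

lemma pl_chain_trans:
  assumes "pl_chain G p l q" "pl_chain G q m r"
  shows "pl_chain G p (l + m) r"
  using assms(2,1)
proof (induction rule: pl_chain.induct)
  case (step q m u v s t)
  then show ?case using pl_chain.step[of G p "l + m" u v s t] by (simp add: add.assoc)
qed simp

lemma pl_chain_edge:
  assumes "(u, v) \<in> edges G" "s \<in> {0..1}" "t \<in> {0..1}"
  shows "pl_chain G (edge_point u v s) \<bar>s - t\<bar> (edge_point u v t)"
proof -
  have "pl_chain G (edge_point u v s) 0 (edge_point u v s)"
    using assms by (intro pl_chain.refl) (auto simp: realization_points_def)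
  from pl_chain.step[OF this assms] show ?thesis by simp
qed

lemma pl_chain_sym: "pl_chain G p l q \<Longrightarrow> pl_chain G q l p"
proof (induction rule: pl_chain.induct)
  case (step p l u v s t)
  have "pl_chain G (edge_point u v t) \<bar>t - s\<bar> (edge_point u v s)"
    using step by (intro pl_chain_edge) auto
  from pl_chain_trans[OF this step.IH] show ?case
    by (simp add: add.commute abs_minus_commute)
qed (rule pl_chain.refl)

lemma pl_chain_coordinate: "pl_chain G p l q \<Longrightarrow> \<bar>p x - q x\<bar> \<le> l"
proof (induction rule: pl_chain.induct)
  case (step p l u v s t)
  have "edge_point u v s x - edge_point u v t x = (s - t) * (indicator {v} x - indicator {u} x)"
    by (simp add: edge_point_def algebra_simps)
  then have "\<bar>edge_point u v s x - edge_point u v t x\<bar> \<le> \<bar>s - t\<bar>"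
    by (auto simp: abs_mult indicator_def)
  with step.IH show ?case by linarith
qed simp

lemma pl_chain_nonneg: "pl_chain G p l q \<Longrightarrow> 0 \<le> l"
  by (induction rule: pl_chain.induct) auto

lemma pl_chain_to_vertex:
  assumes "simple_graph G" "p \<in> realization_points G"
  obtains u l where "u \<in> verts G" "pl_chain G p l (vertex_point u)"
proof -
  consider u where "u \<in> verts G" "p = vertex_point u"
    | u v t where "(u, v) \<in> edges G" "t \<in> {0..1}" "p = edge_point u v t"
    using assms(2) by (auto simp: realization_points_def)
  then show thesis
  proof cases
    case 1
    then show thesis using that[of u 0] pl_chain.refl[OF assms(2)] by simp
  next
    case 2
    then show thesis
      using that[of u "\<bar>t - 0\<bar>"] pl_chain_edge[of u v G t 0] assms(1)
      by (auto simp: edge_point_0 simple_graph_def)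
  qed
qed

lemma pl_chain_exists:
  assumes "simple_graph G" "connected_graph G"
    and "p \<in> realization_points G" "q \<in> realization_points G"
  shows "\<exists>l. pl_chain G p l q"
proof -
  obtain u k where u: "u \<in> verts G" "pl_chain G p k (vertex_point u)"
    using pl_chain_to_vertex assms(1,3) by metis
  obtain v m where v: "v \<in> verts G" "pl_chain G q m (vertex_point v)"
    using pl_chain_to_vertex assms(1,4) by metis
  have "(u, v) \<in> (edges G)\<^sup>*"
    using assms(2) u v by (auto simp: connected_graph_def)
  then have "\<exists>l. pl_chain G (vertex_point u) l (vertex_point v)"
  proof (induction rule: rtrancl_induct)
    case base
    show ?case using u by (metis pl_chain.refl pl_chain_points)
  next
    case (step y z)
    then show ?case
      using pl_chain_edge[of y z G 0 1] pl_chain_trans by (fastforce simp: edge_point_0 edge_point_1)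
  qed
  then show ?thesis using u v pl_chain_trans pl_chain_sym by metis
qed

lemma Metric_space_realization:
  assumes "simple_graph G" "connected_graph G"
  shows "Metric_space (realization_points G) (realization_dist G)"
proof
  have bdd: "bdd_below {l. pl_chain G p l q}" for p q
    using pl_chain_nonneg by (auto intro!: bdd_belowI[of _ 0])
  have ne: "{l. pl_chain G p l q} \<noteq> {}"
    if "p \<in> realization_points G" "q \<in> realization_points G" for p q
    using pl_chain_exists[OF assms that] by auto
  show "0 \<le> realization_dist G p q" for p q
    using ne[of p q] pl_chain_nonneg by (auto simp: realization_dist_def intro!: cInf_greatest)
  show "realization_dist G p q = realization_dist G q p" for p q
  proof -
    have "{l. pl_chain G p l q} = {l. pl_chain G q l p}" using pl_chain_sym by blast
    then show ?thesis by (simp add: realization_dist_def)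
  qed
  fix p q assume p: "p \<in> realization_points G" and q: "q \<in> realization_points G"
  show "realization_dist G p q = 0 \<longleftrightarrow> p = q"
  proof
    assume eq: "realization_dist G p q = 0"
    have "\<bar>p x - q x\<bar> \<le> realization_dist G p q" for x
      using p q ne[OF p q] pl_chain_coordinate
      by (auto simp: realization_dist_def intro!: cInf_greatest)
    then show "p = q" using eq by (intro ext) simp
  next
    assume "p = q"
    then have "realization_dist G p q \<le> 0"
      using p bdd by (auto simp: realization_dist_def intro!: cInf_lower pl_chain.refl)
    moreover have "0 \<le> realization_dist G p q"
      using p q ne[OF p q] pl_chain_nonneg by (auto simp: realization_dist_def intro!: cInf_greatest)
    ultimately show "realization_dist G p q = 0" by simp
  qed
  fix r assume r: "r \<in> realization_points G"
  have "realization_dist G p r \<le> k + m" if "pl_chain G p k q" "pl_chain G q m r" for k m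
    using p r bdd pl_chain_trans[OF that] by (auto simp: realization_dist_def intro!: cInf_lower)
  then have "realization_dist G p r - m \<le> realization_dist G p q" if "pl_chain G q m r" for m
    using p q ne[OF p q] that
    by (simp add: realization_dist_def[of G p q]) (rule cInf_greatest, force+)
  then have "realization_dist G p r - realization_dist G p q \<le> realization_dist G q r"
    using q r ne[OF q r]
    by (simp add: realization_dist_def[of G q r]) (rule cInf_greatest, force+)
  then show "realization_dist G p r \<le> realization_dist G p q + realization_dist G q r"
    by simp
qed

lemma
  assumes "simple_graph G" "connected_graph G"
  shows mspace_realization: "mspace (realization G) = realization_points G"
    and mdist_realization: "mdist (realization G) = realization_dist G"
  using Metric_space_realization[OF assms]
  by (simp_all add: realization_def Metric_space.mspace_metric Metric_space.mdist_metric)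

lemma realization_dist_edge:
  assumes "simple_graph G" "(u, v) \<in> edges G" "s \<in> {0..1}" "t \<in> {0..1}"
  shows "realization_dist G (edge_point u v s) (edge_point u v t) = \<bar>s - t\<bar>"
proof -
  have "u \<noteq> v" using assms(1,2) by (auto simp: simple_graph_def irrefl_def)
  then have "\<bar>s - t\<bar> \<le> l" if "pl_chain G (edge_point u v s) l (edge_point u v t)" for l
    using pl_chain_coordinate[OF that, of v] by (simp add: edge_point_def)
  then have "Inf {l. pl_chain G (edge_point u v s) l (edge_point u v t)} = \<bar>s - t\<bar>"
    using pl_chain_edge[OF assms(2-4)] by (intro cInf_eq_minimum) auto
  then show ?thesis
    using assms by (auto simp: realization_dist_def realization_points_def)
qed


section \<open>Divergence\<close>

definition path_length :: "'p metric \<Rightarrow> (real \<Rightarrow> 'p) \<Rightarrow> ennreal" where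
  "path_length X g =
     (SUP ts \<in> {ts. sorted ts \<and> set ts \<subseteq> {0..1}}.
        \<Sum>i<length ts - 1. ennreal (mdist X (g (ts ! i)) (g (ts ! Suc i))))"

text \<open>
  Divergence takes values in \<open>ennreal\<close>; the infimum over the empty set of paths is \<open>\<infinity>\<close>.
  The ball \<open>mball_of X c \<rho>\<close> is open, and empty if \<open>\<rho> \<le> 0\<close>.
\<close>

definition div_point :: "'p metric \<Rightarrow> real \<Rightarrow> real \<Rightarrow> 'p \<Rightarrow> 'p \<Rightarrow> 'p \<Rightarrow> ennreal" where
  "div_point X \<gamma> \<delta> a b c =
     (let r = min (mdist X c a) (mdist X c b) in
      INF g \<in> {g. pathin (subtopology (mtopology_of X) (mspace X - mball_of X c (\<delta> * r - \<gamma>))) g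
                  \<and> g 0 = a \<and> g 1 = b}.
        path_length X g)"

definition Div :: "'p metric \<Rightarrow> real \<Rightarrow> real \<Rightarrow> real \<Rightarrow> ennreal" where
  "Div X \<gamma> \<delta> n =
     (SUP (a, b, c) \<in> {(a, b, c). a \<in> mspace X \<and> b \<in> mspace X \<and> c \<in> mspace X \<and> mdist X a b \<le> n}.
        div_point X \<gamma> \<delta> a b c)"

definition asymp_le :: "(real \<Rightarrow> ennreal) \<Rightarrow> (real \<Rightarrow> ennreal) \<Rightarrow> bool" where
  "asymp_le f g \<longleftrightarrow>
     (\<exists>A\<ge>1. \<forall>x\<ge>0. f x \<le> ennreal A * g (A * x + A) + ennreal (A * x + A))"

definition asymp_equiv :: "(real \<Rightarrow> ennreal) \<Rightarrow> (real \<Rightarrow> ennreal) \<Rightarrow> bool" where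
  "asymp_equiv f g \<longleftrightarrow> asymp_le f g \<and> asymp_le g f"

definition linear_divergence :: "'p metric \<Rightarrow> bool" where
  "linear_divergence X \<longleftrightarrow>
     (\<exists>\<delta> \<gamma>. 0 < \<delta> \<and> \<delta> < 1 \<and> 0 \<le> \<gamma> \<and> asymp_equiv (Div X \<gamma> \<delta>) (\<lambda>n. ennreal n))"

end

theory Submission
  imports Defs
begin

text \<open>
  Let \<open>c = (f\<^sub>0, a\<^sub>0)\<close>, and let \<open>u\<close>, \<open>v\<close> be at distance at least \<open>r\<close> from \<open>c\<close> and at most \<open>n\<close> from each
  other. If \<open>2n \<le> r\<close>, a geodesic from \<open>u\<close> to \<open>v\<close> stays far from \<open>c\<close>. Otherwise both points are at
  distance \<open>O(n)\<close> from \<open>c\<close>, and it suffices to join them by a detour of length \<open>O(n)\<close> avoiding the ball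
  of radius about \<open>r/4\<close>. A single lamp can certify being that far from \<open>c\<close>: either a lamp at distance
  at least \<open>r/4\<close> from \<open>a\<^sub>0\<close> whose state differs from that in \<open>f\<^sub>0\<close> (available if \<open>A\<close> is infinite), or
  any lamp whose state is at distance at least \<open>r/4\<close> in \<open>B\<close> from that in \<open>f\<^sub>0\<close> (available if \<open>B\<close> is
  infinite). Such a lamp can be set near \<open>u\<close> and near \<open>v\<close>, by a walk that stays far from \<open>c\<close>. As long
  as it is frozen, all other coordinates may be changed freely: replaying any walk with that lamp
  frozen gives a walk that is no longer than the original and far from \<open>c\<close>. If \<open>A\<close> and \<open>B\<close> are
  finite, so is the wreath product, and all balls are empty for large \<open>\<gamma>\<close>.
\<close>

section \<open>Lazy walks and the graph distance\<close>

text \<open>Idle steps make walks monotone in their length bound and stable under maps that collapse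
  edges, as freezing a lamp does.\<close>

inductive lwalk :: "('v \<times> 'v) set \<Rightarrow> 'v set \<Rightarrow> nat \<Rightarrow> 'v \<Rightarrow> 'v \<Rightarrow> bool" for E S where
  refl: "u \<in> S \<Longrightarrow> lwalk E S 0 u u"
| step: "lwalk E S n u v \<Longrightarrow> (v, w) \<in> E\<^sup>= \<Longrightarrow> w \<in> S \<Longrightarrow> lwalk E S (Suc n) u w"

lemma lwalk_ends: "lwalk E S n u v \<Longrightarrow> u \<in> S \<and> v \<in> S"
  by (induction rule: lwalk.induct) auto

lemma lwalk_edge: "(u, v) \<in> E \<Longrightarrow> u \<in> S \<Longrightarrow> v \<in> S \<Longrightarrow> lwalk E S 1 u v"
  unfolding One_nat_def by (intro lwalk.step[OF lwalk.refl]) auto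

lemma lwalk_trans:
  assumes "lwalk E S m u v" "lwalk E S n v w"
  shows "lwalk E S (m + n) u w"
  using assms(2,1) by (induction rule: lwalk.induct) (auto intro: lwalk.step)

lemma lwalk_mono:
  assumes "lwalk E S m u v" "m \<le> n" "S \<subseteq> T"
  shows "lwalk E T n u v"
proof -
  have *: "lwalk E T m u v"
    using assms(1,3) by (induction rule: lwalk.induct) (auto intro: lwalk.intros)
  then have v: "v \<in> T" using lwalk_ends by fast
  show ?thesis
    using assms(2) by (induction rule: dec_induct) (use * v in \<open>auto intro: lwalk.step\<close>)
qed

lemma lwalk_sym:
  assumes "lwalk E S n u v" "sym E"
  shows "lwalk E S n v u"
  using assms(1)
proof (induction rule: lwalk.induct)
  case (step n u v w)
  have "v \<in> S" using step lwalk_ends by fast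
  moreover have "(w, v) \<in> E\<^sup>=" using step assms(2) by (auto simp: sym_def)
  ultimately have "lwalk E S (Suc 0) w v"
    using step by (intro lwalk.step[OF lwalk.refl]) auto
  from lwalk_trans[OF this step.IH] show ?case by simp
qed (rule lwalk.refl)

lemma lwalk_map:
  assumes "lwalk E S n u v"
    and "\<And>u v. (u, v) \<in> E \<Longrightarrow> u \<in> S \<Longrightarrow> v \<in> S \<Longrightarrow> (\<phi> u, \<phi> v) \<in> E'\<^sup>="
    and "\<And>u. u \<in> S \<Longrightarrow> \<phi> u \<in> S'"
  shows "lwalk E' S' n (\<phi> u) (\<phi> v)"
  using assms(1)
proof (induction rule: lwalk.induct)
  case (step n u v w)
  have "v \<in> S" using step lwalk_ends by fast
  then have "(\<phi> v, \<phi> w) \<in> E'\<^sup>=" using step assms(2) by auto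
  then show ?case using step assms(3) by (auto intro: lwalk.step)
qed (auto intro: lwalk.refl assms(3))

definition gdist :: "'v sgraph \<Rightarrow> 'v \<Rightarrow> 'v \<Rightarrow> nat" where
  "gdist G u v = (LEAST n. lwalk (edges G) (verts G) n u v)"

lemma gdist_le:
  assumes "lwalk (edges G) S n u v" "S \<subseteq> verts G"
  shows "gdist G u v \<le> n"
  unfolding gdist_def using lwalk_mono[OF assms(1) order.refl assms(2)] by (rule Least_le)

section \<open>Graph distance in a connected graph\<close>

locale conn_graph =
  fixes G :: "'v sgraph"
  assumes simple: "simple_graph G" and connected: "connected_graph G"
begin

lemma edges_verts: "(u, v) \<in> edges G \<Longrightarrow> u \<in> verts G \<and> v \<in> verts G"
  using simple by (auto simp: simple_graph_def)

lemma sym_edges: "sym (edges G)"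
  using simple by (simp add: simple_graph_def)

lemma edge_neq: "(u, v) \<in> edges G \<Longrightarrow> u \<noteq> v"
  using simple by (auto simp: simple_graph_def irrefl_def)

lemma lwalk_gdist:
  assumes "u \<in> verts G" "v \<in> verts G"
  shows "lwalk (edges G) (verts G) (gdist G u v) u v"
proof -
  have "(u, v) \<in> (edges G)\<^sup>*" using connected assms by (auto simp: connected_graph_def)
  then have "\<exists>n. lwalk (edges G) (verts G) n u v"
  proof (induction rule: rtrancl_induct)
    case base
    show ?case using lwalk.refl[OF assms(1)] by blast
  next
    case (step y z)
    then show ?case using lwalk.step[of _ _ _ u y z] edges_verts by blast
  qed
  then show ?thesis unfolding gdist_def by (rule LeastI_ex)
qed

lemma gdist_self: "u \<in> verts G \<Longrightarrow> gdist G u u = 0"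
  using gdist_le[OF lwalk.refl order.refl] by simp

lemma gdist_eq_0_iff:
  assumes "u \<in> verts G" "v \<in> verts G"
  shows "gdist G u v = 0 \<longleftrightarrow> u = v"
proof
  assume "gdist G u v = 0"
  with lwalk_gdist[OF assms] have "lwalk (edges G) (verts G) 0 u v" by simp
  then show "u = v" by (cases rule: lwalk.cases) auto
qed (use gdist_self assms in auto)

lemma gdist_commute:
  assumes "u \<in> verts G" "v \<in> verts G"
  shows "gdist G u v = gdist G v u"
  by (rule order.antisym; rule gdist_le[OF lwalk_sym[OF lwalk_gdist sym_edges] order.refl])
     (fact assms)+

lemma gdist_triangle:
  assumes "u \<in> verts G" "v \<in> verts G" "w \<in> verts G"
  shows "gdist G u w \<le> gdist G u v + gdist G v w"
  by (rule gdist_le[OF lwalk_trans[OF lwalk_gdist lwalk_gdist] order.refl]) (fact assms)+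

lemma gdist_edge:
  assumes "(u, v) \<in> edges G"
  shows "gdist G u v = 1"
proof -
  note uv = edges_verts[OF assms]
  have "gdist G u v \<le> 1" using gdist_le[OF lwalk_edge[OF assms] order.refl] uv by simp
  moreover have "gdist G u v \<noteq> 0" using gdist_eq_0_iff uv edge_neq[OF assms] by simp
  ultimately show ?thesis by simp
qed

lemma gdist_step:
  assumes "(v, w) \<in> edges G" "u \<in> verts G"
  shows "gdist G u w \<le> gdist G u v + 1"
  using gdist_triangle[OF assms(2), of v w] gdist_edge[OF assms(1)] edges_verts[OF assms(1)] by simp

text \<open>Every vertex on the walk ends an initial segment of length at most
  \<open>n\<close>.\<close>

lemma lwalk_within:
  assumes "lwalk (edges G) (verts G) n u v"
  shows "lwalk (edges G) {w \<in> verts G. gdist G u w \<le> n} n u v"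
  using assms
proof (induction rule: lwalk.induct)
  case (refl u)
  then show ?case by (intro lwalk.refl) (simp add: gdist_self)
next
  case (step n u v w)
  have "gdist G u w \<le> Suc n" using gdist_le[OF lwalk.step[OF step.hyps] order.refl] .
  then show ?case
    using step by (intro lwalk.step[OF lwalk_mono[OF step.IH]]) auto
qed

text \<open>By the triangle inequality, \<open>n\<close> steps come closer to \<open>c\<close> by at
  most \<open>n\<close>. Having \<open>+ n\<close> on the right avoids truncated
  subtraction.\<close>

lemma lwalk_away:
  assumes "lwalk (edges G) (verts G) n u v" "c \<in> verts G" "r \<le> gdist G c u"
  shows "lwalk (edges G) {w \<in> verts G. r \<le> gdist G c w + n} n u v"
proof (rule lwalk_mono[OF lwalk_within[OF assms(1)] order.refl], safe)
  fix w assume w: "w \<in> verts G" "gdist G u w \<le> n"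
  have "u \<in> verts G" using assms(1) lwalk_ends by fast
  then show "r \<le> gdist G c w + n"
    using w assms gdist_triangle[of c w u] gdist_commute[of u w] by linarith
qed

text \<open>Discrete intermediate value argument: the distance from \<open>u\<close> grows by at
  most 1 per step.\<close>

lemma gdist_intermediate:
  assumes "lwalk (edges G) (verts G) n u v" "k \<le> gdist G u v"
  shows "\<exists>w\<in>verts G. gdist G u w = k"
  using assms
proof (induction rule: lwalk.induct)
  case (refl u)
  then show ?case using gdist_self by force
next
  case (step n u v w)
  have "u \<in> verts G" using step lwalk_ends by fast
  then have "gdist G u w \<le> gdist G u v + 1" using step(2) gdist_step by auto
  then show ?case using step by (cases "k \<le> gdist G u v") force+
qed

lemma finite_gdist_ball:
  assumes "locally_finite_graph G" "u \<in> verts G"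
  shows "finite {v \<in> verts G. gdist G u v \<le> n}"
proof (induction n)
  case 0
  have "{v \<in> verts G. gdist G u v \<le> 0} \<subseteq> {u}" using gdist_eq_0_iff assms by auto
  then show ?case using finite_subset by blast
next
  case (Suc n)
  let ?B = "{v \<in> verts G. gdist G u v \<le> n}"
  have "{v \<in> verts G. gdist G u v \<le> Suc n} \<subseteq> ?B \<union> (\<Union>w\<in>?B. {v. (w, v) \<in> edges G})"
  proof safe
    fix v assume v: "v \<in> verts G" "gdist G u v \<le> Suc n"
      and n: "v \<notin> (\<Union>w\<in>?B. {v. (w, v) \<in> edges G})"
    have "lwalk (edges G) (verts G) (Suc n) u v"
      using lwalk_mono[OF lwalk_gdist[OF assms(2) v(1)] v(2)] by simp
    then obtain x where x: "lwalk (edges G) (verts G) n u x" "(x, v) \<in> (edges G)\<^sup>="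
      by (cases rule: lwalk.cases) simp_all
    have "x \<in> verts G" "gdist G u x \<le> n"
      using lwalk_ends[OF x(1)] gdist_le[OF x(1) order.refl] by simp_all
    with x n show "gdist G u v \<le> n" by auto
  qed
  moreover have "finite (?B \<union> (\<Union>w\<in>?B. {v. (w, v) \<in> edges G}))"
    using Suc assms(1) by (auto simp: locally_finite_graph_def)
  ultimately show ?case by (rule finite_subset)
qed

text \<open>Balls are finite, so some vertex lies outside the ball of radius \<open>k\<close>, and a
  walk to it crosses the sphere.\<close>

lemma sphere_nonempty:
  assumes "locally_finite_graph G" "infinite (verts G)" "u \<in> verts G"
  obtains v where "v \<in> verts G" "gdist G u v = k"
proof -
  have "\<not> verts G \<subseteq> {v \<in> verts G. gdist G u v \<le> k}"
    using finite_gdist_ball[OF assms(1,3)] assms(2) finite_subset by blast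
  then obtain v where "v \<in> verts G" "\<not> gdist G u v \<le> k" by auto
  then show thesis using that gdist_intermediate[OF lwalk_gdist[OF assms(3), of v]] by (metis nat_le_linear)
qed

lemma ex_neighbour:
  assumes "\<exists>u\<in>verts G. \<exists>v\<in>verts G. u \<noteq> v" "u \<in> verts G"
  obtains v where "(u, v) \<in> edges G"
proof -
  obtain v where "v \<in> verts G" "v \<noteq> u" using assms by metis
  then have "(u, v) \<in> (edges G)\<^sup>*" using connected assms by (auto simp: connected_graph_def)
  then show thesis using that \<open>v \<noteq> u\<close> by (auto elim: converse_rtranclE)
qed

end


section \<open>Lipschitz paths in the realization\<close>

text \<open>A 1-Lipschitz map on an interval of length \<open>l\<close> is continuous and has length
  at most \<open>l\<close>; both facts survive concatenation and reversal.\<close>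

definition lip_path :: "'p metric \<Rightarrow> 'p set \<Rightarrow> real \<Rightarrow> 'p \<Rightarrow> 'p \<Rightarrow> bool" where
  "lip_path X S l p q \<longleftrightarrow> 0 \<le> l \<and>
     (\<exists>g. g 0 = p \<and> g l = q \<and> g ` {0..l} \<subseteq> S \<and>
          (\<forall>s\<in>{0..l}. \<forall>t\<in>{0..l}. mdist X (g s) (g t) \<le> \<bar>s - t\<bar>))"

lemma mdist_self: "x \<in> mspace X \<Longrightarrow> mdist X x x = 0"
  by simp

lemma lip_path_refl: "p \<in> S \<Longrightarrow> p \<in> mspace X \<Longrightarrow> lip_path X S 0 p p"
  unfolding lip_path_def by (auto intro!: exI[of _ "\<lambda>_. p"] simp: mdist_self)

lemma lip_path_mono: "lip_path X S l p q \<Longrightarrow> S \<subseteq> T \<Longrightarrow> lip_path X T l p q"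
  unfolding lip_path_def by blast

lemma lip_path_trans:
  assumes "lip_path X S l p q" "lip_path X S m q r" "S \<subseteq> mspace X"
  shows "lip_path X S (l + m) p r"
proof -
  obtain g where l: "0 \<le> l" and g: "g 0 = p" "g l = q" "g ` {0..l} \<subseteq> S"
    "\<And>s t. s \<in> {0..l} \<Longrightarrow> t \<in> {0..l} \<Longrightarrow> mdist X (g s) (g t) \<le> \<bar>s - t\<bar>"
    using assms(1) unfolding lip_path_def by blast
  obtain h where m: "0 \<le> m" and h: "h 0 = q" "h m = r" "h ` {0..m} \<subseteq> S"
    "\<And>s t. s \<in> {0..m} \<Longrightarrow> t \<in> {0..m} \<Longrightarrow> mdist X (h s) (h t) \<le> \<bar>s - t\<bar>"
    using assms(2) unfolding lip_path_def by blast
  define k where "k t = (if t \<le> l then g t else h (t - l))" for t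
  have kS: "k t \<in> S" if "t \<in> {0..l + m}" for t
    using that g(3) h(3) by (auto simp: k_def image_subset_iff)
  have kd: "mdist X (k s) (k t) \<le> t - s" if "s \<in> {0..l + m}" "t \<in> {0..l + m}" "s \<le> t" for s t
  proof -
    consider "t \<le> l" | "s \<le> l" "l < t" | "l < s" using that by linarith
    then show ?thesis
    proof cases
      case 1
      then show ?thesis using g(4)[of s t] that by (simp add: k_def)
    next
      case 2
      \<comment> \<open>The two times lie on different pieces, so the estimate passes through the
        junction \<open>q\<close>.\<close>
      have *: "g s \<in> S" "h (t - l) \<in> S" "q \<in> S"
        using 2 that l m g(2,3) h(3) by (auto simp: image_subset_iff)
      then have "mdist X (g s) (h (t - l)) \<le> mdist X (g s) q + mdist X q (h (t - l))"
        using assms(3) by (intro mdist_triangle) auto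
      also have "\<dots> \<le> (l - s) + (t - l)"
        using g(4)[of s l] h(4)[of 0 "t - l"] 2 that l m g(2) h(1) by auto
      finally show ?thesis using 2 by (simp add: k_def)
    next
      case 3
      then show ?thesis using h(4)[of "s - l" "t - l"] that by (simp add: k_def)
    qed
  qed
  have "mdist X (k s) (k t) \<le> \<bar>s - t\<bar>" if "s \<in> {0..l + m}" "t \<in> {0..l + m}" for s t
    using kd[of s t] kd[of t s] that mdist_commute[of X "k s" "k t"] by linarith
  moreover have "k (l + m) = r" "k 0 = p"
    using l m g(1,2) h(1,2) by (auto simp: k_def)
  ultimately show ?thesis
    unfolding lip_path_def using l m kS by (intro conjI exI[of _ k]) auto
qed

lemma lip_path_sym:
  assumes "lip_path X S l p q"
  shows "lip_path X S l q p"
proof -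
  obtain g where l: "0 \<le> l" and g: "g 0 = p" "g l = q" "g ` {0..l} \<subseteq> S"
    "\<And>s t. s \<in> {0..l} \<Longrightarrow> t \<in> {0..l} \<Longrightarrow> mdist X (g s) (g t) \<le> \<bar>s - t\<bar>"
    using assms unfolding lip_path_def by blast
  have "mdist X (g (l - s)) (g (l - t)) \<le> \<bar>s - t\<bar>" if "s \<in> {0..l}" "t \<in> {0..l}" for s t
    using g(4)[of "l - s" "l - t"] that by auto
  then show ?thesis
    unfolding lip_path_def using l g(1-3)
    by (intro conjI exI[of _ "\<lambda>t. g (l - t)"]) (auto simp: image_subset_iff)
qed

text \<open>For every subdivision, the sum of distances is bounded by a telescoping sum.\<close>

lemma path_length_le:
  assumes "0 \<le> l" "\<And>s t. s \<in> {0..1} \<Longrightarrow> t \<in> {0..1} \<Longrightarrow> mdist X (g s) (g t) \<le> l * \<bar>s - t\<bar>"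
  shows "path_length X g \<le> ennreal l"
  unfolding path_length_def
proof (rule SUP_least, safe)
  fix ts :: "real list" assume ts: "sorted ts" "set ts \<subseteq> {0..1}"
  have in01: "ts ! i \<in> {0..1}" if "i < length ts" for i
    using ts(2) that nth_mem by blast
  have "(\<Sum>i<length ts - 1. ennreal (mdist X (g (ts ! i)) (g (ts ! Suc i))))
      \<le> (\<Sum>i<length ts - 1. ennreal (l * (ts ! Suc i - ts ! i)))"
  proof (intro sum_mono ennreal_leI)
    fix i assume "i \<in> {..<length ts - 1}"
    then have "i < length ts" "Suc i < length ts" by auto
    then show "mdist X (g (ts ! i)) (g (ts ! Suc i)) \<le> l * (ts ! Suc i - ts ! i)"
      using assms(2)[OF in01 in01, of i "Suc i"] sorted_nth_mono[OF ts(1), of i "Suc i"] by simp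
  qed
  also have "\<dots> = ennreal (\<Sum>i<length ts - 1. l * (ts ! Suc i - ts ! i))"
    using assms(1) sorted_nth_mono[OF ts(1)] by (intro sum_ennreal mult_nonneg_nonneg) auto
  also have "\<dots> \<le> ennreal l"
  proof (cases "ts = []")
    case False
    have "(\<Sum>i<length ts - 1. l * (ts ! Suc i - ts ! i)) = l * (ts ! (length ts - 1) - ts ! 0)"
      by (simp add: sum_distrib_left[symmetric] sum_lessThan_telescope)
    also have "\<dots> \<le> l * 1"
      using False in01[of "length ts - 1"] in01[of 0] assms(1) by (intro mult_left_mono) auto
    finally show ?thesis by (simp add: ennreal_leI)
  qed simp
  finally show "(\<Sum>i<length ts - 1. ennreal (mdist X (g (ts ! i)) (g (ts ! Suc i)))) \<le> ennreal l" .
qed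

text \<open>Rescaled to \<open>{0..1}\<close>, the path is \<open>l\<close>-Lipschitz, hence
  continuous and of length at most \<open>l\<close>. The set in the hypothesis is the complement of
  the ball in \<open>div_point\<close>.\<close>

lemma div_point_le:
  assumes "lip_path X {p \<in> mspace X. \<delta> * min (mdist X c a) (mdist X c b) - \<gamma> \<le> mdist X c p} l a b"
    and "c \<in> mspace X"
  shows "div_point X \<gamma> \<delta> a b c \<le> ennreal l"
proof -
  let ?r = "\<delta> * min (mdist X c a) (mdist X c b) - \<gamma>"
  obtain g where l: "0 \<le> l" and g: "g 0 = a" "g l = b"
    "\<And>t. t \<in> {0..l} \<Longrightarrow> g t \<in> mspace X" "\<And>t. t \<in> {0..l} \<Longrightarrow> ?r \<le> mdist X c (g t)"
    "\<And>s t. s \<in> {0..l} \<Longrightarrow> t \<in> {0..l} \<Longrightarrow> mdist X (g s) (g t) \<le> \<bar>s - t\<bar>"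
    using assms(1) unfolding lip_path_def by blast
  define h where "h t = g (l * t)" for t
  have lt: "l * t \<in> {0..l}" if "t \<in> {0..1}" for t
    using that l by (auto simp: mult_left_le)
  have hd: "mdist X (h s) (h t) \<le> l * \<bar>s - t\<bar>" if "s \<in> {0..1}" "t \<in> {0..1}" for s t
    using g(5)[OF lt lt, OF that] l by (simp add: h_def right_diff_distrib[symmetric] abs_mult)
  have "Lipschitz_continuous_map (submetric euclidean_metric {0..1}) X h"
    unfolding Lipschitz_continuous_map_def
    using hd g(3) lt by (auto simp: h_def dist_real_def intro!: exI[of _ l])
  then have "continuous_map (mtopology_of (submetric euclidean_metric {0..1})) (mtopology_of X) h"
    by (rule Lipschitz_continuous_imp_continuous_map)
  then have "pathin (mtopology_of X) h"
    by (simp add: pathin_def mtopology_of_submetric)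
  moreover have "h t \<in> mspace X - mball_of X c ?r" if "t \<in> {0..1}" for t
    using g(3,4)[OF lt[OF that]] assms(2) by (auto simp: h_def)
  ultimately have "pathin (subtopology (mtopology_of X) (mspace X - mball_of X c ?r)) h"
    by (auto simp: pathin_subtopology)
  moreover have "h 0 = a" "h 1 = b" using g(1,2) by (auto simp: h_def)
  ultimately have "div_point X \<gamma> \<delta> a b c \<le> path_length X h"
    unfolding div_point_def Let_def by (intro INF_lower) auto
  also have "\<dots> \<le> ennreal l" using path_length_le[OF l hd] .
  finally show ?thesis .
qed

lemma lip_path_mdist:
  assumes "lip_path X S l p q"
  shows "mdist X p q \<le> l"
proof -
  obtain g where "0 \<le> l" "g 0 = p" "g l = q"
    "\<And>s t. s \<in> {0..l} \<Longrightarrow> t \<in> {0..l} \<Longrightarrow> mdist X (g s) (g t) \<le> \<bar>s - t\<bar>"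
    using assms unfolding lip_path_def by blast
  from this(4)[of 0 l] this(1-3) show ?thesis by simp
qed

section \<open>Affine extension of vertex functions\<close>

text \<open>Points of the realization have at most two nonzero coordinates, so the sum over the
  support is finite there.\<close>

definition affine_ext :: "('v \<Rightarrow> real) \<Rightarrow> ('v \<Rightarrow> real) \<Rightarrow> real" where
  "affine_ext F p = (\<Sum>x | p x \<noteq> 0. p x * F x)"

lemma affine_ext_vertex: "affine_ext F (vertex_point v) = F v"
proof -
  have "{x. vertex_point v x \<noteq> 0} = {v}" by (auto simp: vertex_point_def indicator_def)
  then show ?thesis by (simp add: affine_ext_def vertex_point_def)
qed

lemma affine_ext_edge:
  assumes "u \<noteq> v"
  shows "affine_ext F (edge_point u v t) = (1 - t) * F u + t * F v"
proof -
  have "affine_ext F (edge_point u v t) = (\<Sum>x\<in>{u, v}. edge_point u v t x * F x)"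
    unfolding affine_ext_def
    by (rule sum.mono_neutral_left) (auto simp: edge_point_def indicator_def split: if_splits)
  then show ?thesis using assms by (simp add: edge_point_def)
qed

text \<open>On an edge the extension has slope \<open>F v - F u\<close>, and the bounds add up along
  the chain.\<close>

lemma affine_ext_lipschitz:
  assumes "simple_graph G" "\<And>u v. (u, v) \<in> edges G \<Longrightarrow> \<bar>F u - F v\<bar> \<le> 1"
    and "pl_chain G p l q"
  shows "\<bar>affine_ext F p - affine_ext F q\<bar> \<le> l"
  using assms(3)
proof (induction rule: pl_chain.induct)
  case (step p l u v s t)
  have "u \<noteq> v" using step assms(1) by (auto simp: simple_graph_def irrefl_def)
  then have "affine_ext F (edge_point u v s) - affine_ext F (edge_point u v t) = (s - t) * (F v - F u)"
    by (simp add: affine_ext_edge algebra_simps)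
  moreover have "\<bar>(s - t) * (F v - F u)\<bar> \<le> \<bar>s - t\<bar> * 1"
    unfolding abs_mult using assms(2)[OF step.hyps(2)] by (intro mult_left_mono) auto
  ultimately have "\<bar>affine_ext F (edge_point u v s) - affine_ext F (edge_point u v t)\<bar> \<le> \<bar>s - t\<bar>"
    by simp
  then show ?case using step.IH by linarith
qed simp

section \<open>Walks and distances in the realization\<close>

context conn_graph
begin

abbreviation "X \<equiv> realization G"

lemma mspace_X: "mspace X = realization_points G"
  and mdist_X: "mdist X = realization_dist G"
  using mspace_realization mdist_realization simple connected by blast+

lemma vertex_in_X: "v \<in> verts G \<Longrightarrow> vertex_point v \<in> mspace X"
  by (auto simp: mspace_X realization_points_def)

lemma edge_in_X: "(u, v) \<in> edges G \<Longrightarrow> t \<in> {0..1} \<Longrightarrow> edge_point u v t \<in> mspace X"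
  by (auto simp: mspace_X realization_points_def)

lemma mdist_edge:
  assumes "(u, v) \<in> edges G" "s \<in> {0..1}" "t \<in> {0..1}"
  shows "mdist X (edge_point u v s) (edge_point u v t) = \<bar>s - t\<bar>"
  using realization_dist_edge[OF simple assms] by (simp add: mdist_X)

text \<open>This neighbourhood contains every edge with an end in \<open>S\<close>, hence the path
  traced by a walk in \<open>S\<close>.\<close>

definition nbhd :: "'v set \<Rightarrow> ('v \<Rightarrow> real) set" where
  "nbhd S = {p \<in> mspace X. \<exists>w\<in>S. mdist X (vertex_point w) p \<le> 1}"

lemma edge_in_nbhd:
  assumes "(v, w) \<in> edges G" "v \<in> S" "t \<in> {0..1}"
  shows "edge_point v w t \<in> nbhd S"
proof -
  have "mdist X (vertex_point v) (edge_point v w t) \<le> 1"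
    using mdist_edge[OF assms(1), of 0 t] assms(3) by (simp add: edge_point_0)
  then show ?thesis using assms edge_in_X unfolding nbhd_def by blast
qed

lemma vertex_in_nbhd:
  assumes "v \<in> S" "v \<in> verts G"
  shows "vertex_point v \<in> nbhd S"
proof -
  have "mdist X (vertex_point v) (vertex_point v) \<le> 1"
    using mdist_self[OF vertex_in_X[OF assms(2)]] by simp
  then show ?thesis using assms vertex_in_X unfolding nbhd_def by blast
qed

text \<open>Edges are traversed at unit speed and idle steps take no time, so the length may fall
  short of \<open>n\<close>.\<close>

lemma lip_path_lwalk:
  assumes "lwalk (edges G) S n u v" "S \<subseteq> verts G"
  shows "\<exists>l\<le>real n. lip_path X (nbhd S) l (vertex_point u) (vertex_point v)"
  using assms(1)
proof (induction rule: lwalk.induct)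
  case (refl u)
  then have "u \<in> verts G" using assms(2) by blast
  then have "lip_path X (nbhd S) 0 (vertex_point u) (vertex_point u)"
    using refl by (intro lip_path_refl vertex_in_nbhd vertex_in_X)
  then show ?case by (intro exI[of _ "0::real"]) simp
next
  case (step n u v w)
  obtain l where l: "l \<le> real n" "lip_path X (nbhd S) l (vertex_point u) (vertex_point v)"
    using step.IH by blast
  show ?case
  proof (cases "v = w")
    case True
    then show ?thesis using l by (intro exI[of _ l]) simp
  next
    case False
    with step.hyps have e: "(v, w) \<in> edges G" by simp
    have v: "v \<in> S" using step.hyps(1) lwalk_ends by fast
    have "lip_path X (nbhd S) 1 (vertex_point v) (vertex_point w)"
      unfolding lip_path_def using mdist_edge[OF e] edge_in_nbhd[OF e v]
      by (intro conjI exI[of _ "edge_point v w"]) (simp_all add: edge_point_0 edge_point_1 image_subset_iff)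
    moreover have "nbhd S \<subseteq> mspace X" by (auto simp: nbhd_def)
    ultimately have "lip_path X (nbhd S) (l + 1) (vertex_point u) (vertex_point w)"
      using lip_path_trans[OF l(2)] by blast
    then show ?thesis using l(1) by (intro exI[of _ "l + 1"]) simp
  qed
qed

text \<open>A shortest walk gives the upper bound. For the lower bound, the affine extension of the
  distance from \<open>u\<close> changes along a chain by at most its length.\<close>

lemma mdist_vertices:
  assumes "u \<in> verts G" "v \<in> verts G"
  shows "mdist X (vertex_point u) (vertex_point v) = gdist G u v"
proof (rule order.antisym)
  show "mdist X (vertex_point u) (vertex_point v) \<le> gdist G u v"
    using lip_path_lwalk[OF lwalk_gdist[OF assms] order.refl] lip_path_mdist by fastforce
  let ?F = "\<lambda>w. real (gdist G u w)"
  have "\<bar>?F x - ?F y\<bar> \<le> 1" if "(x, y) \<in> edges G" for x y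
    using gdist_step[OF that assms(1)] gdist_step[of y x u] that sym_edges assms(1)
    by (auto simp: sym_def)
  then have "gdist G u v \<le> l" if "pl_chain G (vertex_point u) l (vertex_point v)" for l :: real
    using affine_ext_lipschitz[OF simple _ that, of ?F] assms(1)
    by (simp add: affine_ext_vertex gdist_self)
  then have "real (gdist G u v) \<le> Inf {l. pl_chain G (vertex_point u) l (vertex_point v)}"
    using pl_chain_exists[OF simple connected] assms vertex_in_X
    by (intro cInf_greatest) (auto simp: mspace_X)
  then show "gdist G u v \<le> mdist X (vertex_point u) (vertex_point v)"
    using assms vertex_in_X by (simp add: mdist_X realization_dist_def mspace_X)
qed

lemma lip_path_near_vertex:
  assumes "p \<in> mspace X"
  obtains u l where "u \<in> verts G" "l \<le> 1"
    "lip_path X {q \<in> mspace X. mdist X p q \<le> 1} l p (vertex_point u)"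
proof -
  consider u where "u \<in> verts G" "p = vertex_point u"
    | u v t where "(u, v) \<in> edges G" "t \<in> {0..1}" "p = edge_point u v t"
    using assms by (auto simp: realization_points_def mspace_X)
  then show thesis
  proof cases
    case 1
    then show thesis
      using that[of u 0] lip_path_refl[of p _ X] assms by (simp add: mdist_self)
  next
    case 2
    have "lip_path X {q \<in> mspace X. mdist X p q \<le> 1} t p (vertex_point u)"
      unfolding lip_path_def 2(3) using 2(2) edge_in_X[OF 2(1)] mdist_edge[OF 2(1)]
      by (intro conjI exI[of _ "\<lambda>s. edge_point u v (t - s)"]) (auto simp: edge_point_0)
    then show thesis using that[of u t] 2 edges_verts by auto
  qed
qed

text \<open>The radius lost by passing from points to nearby vertices is absorbed in \<open>\<gamma>\<close>.\<close>

lemma linear_divergence_if_lwalks: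
  fixes K :: nat
  assumes "\<And>c u v r n. \<lbrakk>c \<in> verts G; u \<in> verts G; v \<in> verts G; r \<le> gdist G c u; r \<le> gdist G c v;
      gdist G u v \<le> n\<rbrakk> \<Longrightarrow> lwalk (edges G) {w \<in> verts G. r \<le> 4 * gdist G c w + K} (K * n + K) u v"
  shows "linear_divergence X"
proof -
  \<comment> \<open>Points near the walk turn out to have distance at least
    \<open>\<rho> / 4 - (K + 11) / 4\<close> from \<open>c\<close>, and \<open>K + 10\<close>
    exceeds this loss.\<close>
  let ?\<gamma> = "real K + 10"
  have point: "div_point X ?\<gamma> (1 / 4) a b c \<le> ennreal (real (4 * K + 2) * x + real (4 * K + 2))"
    if abc: "a \<in> mspace X" "b \<in> mspace X" "c \<in> mspace X" "mdist X a b \<le> x" for a b c and x :: real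
  proof -
    define \<rho> where "\<rho> = min (mdist X c a) (mdist X c b)"
    \<comment> \<open>Replacing \<open>c\<close> and an endpoint by nearby vertices costs at most 2,
      rounding down less than 1. A negative value becomes 0, for which the bounds below still
      hold.\<close>
    define r where "r = nat \<lfloor>\<rho> - 2\<rfloor>"
    define n where "n = nat \<lceil>x + 2\<rceil>"
    have \<rho>: "0 \<le> \<rho>" "\<rho> \<le> mdist X c a" "\<rho> \<le> mdist X c b"
      by (auto simp: \<rho>_def)
    have x: "0 \<le> x" using abc(4) mdist_nonneg[of X a b] by linarith
    have r: "\<rho> - 3 \<le> r" unfolding r_def by linarith
    have n: "x + 2 \<le> n" "n \<le> x + 3" unfolding n_def using x by linarith+
    define S where "S = {p \<in> mspace X. 1 / 4 * \<rho> - ?\<gamma> \<le> mdist X c p}"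
    obtain c' l where c': "c' \<in> verts G" "l \<le> 1"
      "lip_path X {q \<in> mspace X. mdist X c q \<le> 1} l c (vertex_point c')"
      by (rule lip_path_near_vertex[OF abc(3)])
    obtain a' la where a': "a' \<in> verts G" "la \<le> 1"
      "lip_path X {q \<in> mspace X. mdist X a q \<le> 1} la a (vertex_point a')"
      by (rule lip_path_near_vertex[OF abc(1)])
    obtain b' lb where b': "b' \<in> verts G" "lb \<le> 1"
      "lip_path X {q \<in> mspace X. mdist X b q \<le> 1} lb b (vertex_point b')"
      by (rule lip_path_near_vertex[OF abc(2)])
    have d: "mdist X c (vertex_point c') \<le> 1" "mdist X a (vertex_point a') \<le> 1"
      "mdist X b (vertex_point b') \<le> 1"
      using lip_path_mdist[OF c'(3)] lip_path_mdist[OF a'(3)] lip_path_mdist[OF b'(3)] c'(2) a'(2) b'(2)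
      by linarith+
    note V = vertex_in_X[OF a'(1)] vertex_in_X[OF b'(1)] vertex_in_X[OF c'(1)]
    have near: "{q \<in> mspace X. mdist X e q \<le> 1} \<subseteq> S" if "e \<in> mspace X" "\<rho> \<le> mdist X c e" for e
    proof safe
      fix q assume q: "q \<in> mspace X" "mdist X e q \<le> 1"
      have "mdist X c e \<le> mdist X c q + mdist X q e"
        using mdist_triangle[OF abc(3) q(1) that(1)] .
      then have "1 / 4 * \<rho> - ?\<gamma> \<le> mdist X c q"
        using q(2) that(2) \<rho>(1) mdist_commute[of X q e] by linarith
      then show "q \<in> S" using q(1) unfolding S_def by blast
    qed
    have "mdist X c e \<le> mdist X (vertex_point c') (vertex_point e') + 2"
      if "e \<in> mspace X" "e' \<in> verts G" "mdist X e (vertex_point e') \<le> 1" for e e'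
      using mdist_triangle[of c X "vertex_point c'" e]
        mdist_triangle[of "vertex_point c'" X "vertex_point e'" e]
        that V abc d vertex_in_X[OF that(2)] mdist_commute[of X e "vertex_point e'"] by linarith
    from this[OF abc(1) a'(1) d(2)] this[OF abc(2) b'(1) d(3)]
    have "\<rho> - 2 \<le> gdist G c' a'" "\<rho> - 2 \<le> gdist G c' b'"
      using mdist_vertices[OF c'(1) a'(1)] mdist_vertices[OF c'(1) b'(1)] \<rho> by linarith+
    then have rab: "r \<le> gdist G c' a'" "r \<le> gdist G c' b'"
      unfolding r_def by linarith+
    have "mdist X (vertex_point a') (vertex_point b') \<le> mdist X a b + 2"
      using mdist_triangle[of "vertex_point a'" X a "vertex_point b'"]
        mdist_triangle[of a X b "vertex_point b'"]
        V abc d mdist_commute[of X a "vertex_point a'"] by linarith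
    then have dab: "gdist G a' b' \<le> n"
      using mdist_vertices[OF a'(1) b'(1)] abc(4) n by linarith
    have "lwalk (edges G) {w \<in> verts G. r \<le> 4 * gdist G c' w + K} (K * n + K) a' b'"
      using assms[OF c'(1) a'(1) b'(1) rab dab] .
    then obtain m where m: "m \<le> real (K * n + K)"
      "lip_path X (nbhd {w \<in> verts G. r \<le> 4 * gdist G c' w + K}) m (vertex_point a') (vertex_point b')"
      using lip_path_lwalk by blast
    have "nbhd {w \<in> verts G. r \<le> 4 * gdist G c' w + K} \<subseteq> S"
      unfolding nbhd_def
    proof safe
      fix p w assume p: "p \<in> mspace X" and w: "w \<in> verts G" "r \<le> 4 * gdist G c' w + K"
        "mdist X (vertex_point w) p \<le> 1"
      have "mdist X (vertex_point c') (vertex_point w) \<le> mdist X c p + 2"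
        using mdist_triangle[of "vertex_point c'" X c "vertex_point w"]
          mdist_triangle[of c X p "vertex_point w"]
          V p abc d w(3) vertex_in_X[OF w(1)] mdist_commute[of X p "vertex_point w"]
          mdist_commute[of X c "vertex_point c'"] by linarith
      moreover have "real r \<le> 4 * gdist G c' w + K" using w(2) by linarith
      ultimately have "1 / 4 * \<rho> - ?\<gamma> \<le> mdist X c p"
        using r \<rho>(1) mdist_vertices[OF c'(1) w(1)] by linarith
      then show "p \<in> S" using p unfolding S_def by blast
    qed
    then have "lip_path X S m (vertex_point a') (vertex_point b')"
      using lip_path_mono[OF m(2)] by blast
    moreover have "lip_path X S la a (vertex_point a')" "lip_path X S lb b (vertex_point b')"
      using lip_path_mono[OF a'(3) near[OF abc(1) \<rho>(2)]]
        lip_path_mono[OF b'(3) near[OF abc(2) \<rho>(3)]] by blast+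
    moreover have "S \<subseteq> mspace X" by (auto simp: S_def)
    ultimately have "lip_path X S (la + m + lb) a b"
      by (meson lip_path_trans lip_path_sym)
    then have "div_point X ?\<gamma> (1 / 4) a b c \<le> ennreal (la + m + lb)"
      using abc(3) unfolding S_def \<rho>_def by (rule div_point_le)
    also have "\<dots> \<le> ennreal (real (4 * K + 2) * x + real (4 * K + 2))"
    proof (rule ennreal_leI)
      \<comment> \<open>The two connecting pieces and \<open>K * n + K\<close> with
        \<open>n \<le> x + 3\<close> add up to at most \<open>K * x + 4 * K + 2\<close>, whence the
        constant \<open>4 * K + 2\<close>.\<close>
      have "real K * real n \<le> real K * (x + 3)" using n by (intro mult_left_mono) auto
      then have "la + m + lb \<le> real K * x + 4 * real K + 2"
        using a'(2) b'(2) m(1) by (simp add: algebra_simps)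
      also have "\<dots> \<le> real (4 * K + 2) * x + real (4 * K + 2)"
        using x by (simp add: algebra_simps)
      finally show "la + m + lb \<le> real (4 * K + 2) * x + real (4 * K + 2)" .
    qed
    finally show ?thesis .
  qed
  have "asymp_le (Div X ?\<gamma> (1 / 4)) (\<lambda>n. ennreal n)"
    unfolding asymp_le_def
  proof (intro exI[of _ "real (4 * K + 2)"] conjI allI impI)
    fix x :: real assume "0 \<le> x"
    have "Div X ?\<gamma> (1 / 4) x \<le> ennreal (real (4 * K + 2) * x + real (4 * K + 2))"
      unfolding Div_def by (rule SUP_least) (use point in auto)
    then show "Div X ?\<gamma> (1 / 4) x \<le> ennreal (real (4 * K + 2)) *
        ennreal (real (4 * K + 2) * x + real (4 * K + 2)) +
        ennreal (real (4 * K + 2) * x + real (4 * K + 2))"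
      by (rule order.trans) (simp add: add_increasing)
  qed simp
  \<comment> \<open>With constant 1, the additive term \<open>x + 1\<close> dominates
    \<open>x\<close>.\<close>
  moreover have "asymp_le (\<lambda>n. ennreal n) (Div X ?\<gamma> (1 / 4))"
    unfolding asymp_le_def
    by (intro exI[of _ 1] conjI allI impI) (auto intro!: add_increasing ennreal_leI)
  ultimately show ?thesis
    unfolding linear_divergence_def asymp_equiv_def
    by (intro exI[of _ "1 / 4"] exI[of _ ?\<gamma>]) auto
qed

end


section \<open>Detours in the wreath product\<close>

locale wreath_graphs = A: conn_graph A + B: conn_graph B
  for A :: "'a sgraph" and B :: "'b sgraph" +
  fixes b\<^sub>0 :: 'b
  assumes b0: "b\<^sub>0 \<in> verts B"
begin

abbreviation "W \<equiv> wreath B b\<^sub>0 A"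

sublocale W: conn_graph W
  by unfold_locales
     (rule simple_graph_wreath[OF A.simple B.simple]
       connected_graph_wreath[OF A.simple A.connected B.simple B.connected b0])+

lemma mem_W: "(f, a) \<in> verts W \<longleftrightarrow>
    f \<in> verts A \<rightarrow>\<^sub>E verts B \<and> finite {x \<in> verts A. f x \<noteq> b\<^sub>0} \<and> a \<in> verts A"
  by (simp add: wreath_def wreath_verts_def)

lemma snd_W: "u \<in> verts W \<Longrightarrow> snd u \<in> verts A"
  by (cases u) (simp add: mem_W)

lemma lamp_W: "u \<in> verts W \<Longrightarrow> x \<in> verts A \<Longrightarrow> fst u x \<in> verts B"
  by (cases u) (auto simp: mem_W)

lemma move_W: "(f, a) \<in> verts W \<Longrightarrow> c \<in> verts A \<Longrightarrow> (f, c) \<in> verts W"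
  by (simp add: mem_W)

lemma upd_W:
  assumes "(f, a) \<in> verts W" "y \<in> verts A" "w \<in> verts B"
  shows "(f(y := w), a) \<in> verts W"
proof -
  have "finite {x \<in> verts A. (f(y := w)) x \<noteq> b\<^sub>0}"
    by (rule finite_subset[of _ "insert y {x \<in> verts A. f x \<noteq> b\<^sub>0}"])
       (use assms in \<open>auto simp: mem_W\<close>)
  then show ?thesis
    using assms by (auto simp: mem_W PiE_iff extensional_def)
qed

lemma edge_W: "((f, a), (g, c)) \<in> edges W \<longleftrightarrow> (f, a) \<in> verts W \<and> (g, c) \<in> verts W \<and>
    (a = c \<and> (\<forall>x\<in>verts A. x \<noteq> a \<longrightarrow> f x = g x) \<and> (f a, g a) \<in> edges B \<or> f = g \<and> (a, c) \<in> edges A)"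
  by (simp add: wreath_def)

section \<open>Freezing a lamp\<close>

text \<open>Not a move of the walker: the lamp is overwritten wherever the walker stands. For
  \<open>y\<close> in \<open>A\<close> and \<open>w\<close> in \<open>B\<close> this retracts the
  vertices of \<open>W\<close> onto the states whose lamp at \<open>y\<close> shows
  \<open>w\<close>.\<close>

definition set_lamp :: "'a \<Rightarrow> 'b \<Rightarrow> ('a \<Rightarrow> 'b) \<times> 'a \<Rightarrow> ('a \<Rightarrow> 'b) \<times> 'a" where
  "set_lamp y w u = ((fst u)(y := w), snd u)"

lemma set_lamp_W: "u \<in> verts W \<Longrightarrow> y \<in> verts A \<Longrightarrow> w \<in> verts B \<Longrightarrow> set_lamp y w u \<in> verts W"
  by (cases u) (simp add: set_lamp_def upd_W)

lemma set_lamp_triv: "fst u y = w \<Longrightarrow> set_lamp y w u = u"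
  by (auto simp: set_lamp_def)

lemma set_lamp_commute: "y \<noteq> y' \<Longrightarrow> set_lamp y w (set_lamp y' w' u) = set_lamp y' w' (set_lamp y w u)"
  by (simp add: set_lamp_def fun_upd_twist)

text \<open>Freezing a lamp turns a walk into a lazy walk: the edges switching that lamp collapse.\<close>

lemma lwalk_set_lamp:
  assumes "lwalk (edges W) (verts W) n u v" "y \<in> verts A" "w \<in> verts B"
  shows "lwalk (edges W) {s \<in> verts W. fst s y = w} n (set_lamp y w u) (set_lamp y w v)"
proof (rule lwalk_map[OF assms(1)])
  fix u v assume e: "(u, v) \<in> edges W"
  obtain f a g c where uv: "u = (f, a)" "v = (g, c)" by (cases u, cases v)
  have V: "set_lamp y w u \<in> verts W" "set_lamp y w v \<in> verts W"
    using W.edges_verts[OF e] set_lamp_W assms by blast+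
  consider "a = c" "\<forall>x\<in>verts A. x \<noteq> a \<longrightarrow> f x = g x" "(f a, g a) \<in> edges B"
    | "f = g" "(a, c) \<in> edges A"
    using e by (auto simp: uv edge_W)
  then show "(set_lamp y w u, set_lamp y w v) \<in> (edges W)\<^sup>="
  proof cases
    case 1
    show ?thesis
    proof (cases "y = a")
      case True
      have "(f(y := w)) x = (g(y := w)) x" for x
        using 1 True W.edges_verts[OF e] PiE_arb[of f "verts A" "\<lambda>_. verts B" x]
          PiE_arb[of g "verts A" "\<lambda>_. verts B" x]
        by (cases "x \<in> verts A") (auto simp: uv mem_W)
      then show ?thesis using 1(1) by (auto simp: set_lamp_def uv)
    next
      case False
      then show ?thesis using 1 V by (auto simp: set_lamp_def uv edge_W)
    qed
  next
    case 2
    then show ?thesis using V by (auto simp: set_lamp_def uv edge_W)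
  qed
next
  fix u assume "u \<in> verts W"
  then show "set_lamp y w u \<in> {s \<in> verts W. fst s y = w}"
    using set_lamp_W assms by (auto simp: set_lamp_def)
qed

lemma lwalk_move:
  assumes "(f, a) \<in> verts W" "lwalk (edges A) (verts A) n a c"
  shows "lwalk (edges W) (verts W) n (f, a) (f, c)"
  using assms(2)
  by (rule lwalk_map) (use assms(1) move_W in \<open>auto simp: edge_W\<close>)

lemma lwalk_lamp:
  assumes "(f, y) \<in> verts W" "lwalk (edges B) (verts B) n (f y) w"
  shows "lwalk (edges W) {s \<in> verts W. snd s = y} n (f, y) (f(y := w), y)"
proof -
  have y: "y \<in> verts A" using assms(1) by (simp add: mem_W)
  have "lwalk (edges W) {s \<in> verts W. snd s = y} n (f(y := f y), y) (f(y := w), y)"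
  proof (rule lwalk_map[OF assms(2), of "\<lambda>b. (f(y := b), y)"])
    fix b b' assume "(b, b') \<in> edges B"
    then have "((f(y := b), y), (f(y := b'), y)) \<in> edges W"
      using upd_W[OF assms(1) y] B.edges_verts unfolding edge_W by simp
    then show "((f(y := b), y), (f(y := b'), y)) \<in> (edges W)\<^sup>=" by blast
  qed (use upd_W[OF assms(1) y] in simp)
  then show ?thesis by simp
qed

section \<open>Lower bounds for distances in the wreath product\<close>

text \<open>Forgetting the lamps maps a walk to a lazy walk in \<open>A\<close>: switching edges
  become idle steps.\<close>

lemma gdist_snd_le:
  assumes "lwalk (edges W) (verts W) n u v"
  shows "gdist A (snd u) (snd v) \<le> n"
proof -
  have "lwalk (edges A) (verts A) n (snd u) (snd v)"
    using assms by (rule lwalk_map) (auto simp: edge_W snd_W)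
  then show ?thesis by (rule gdist_le[OF _ order.refl])
qed

text \<open>Reading one lamp maps a walk to a lazy walk in \<open>B\<close>: only switches at
  \<open>y\<close> change the value.\<close>

lemma gdist_lamp_le:
  assumes "lwalk (edges W) (verts W) n u v" "y \<in> verts A"
  shows "gdist B (fst u y) (fst v y) \<le> n"
proof -
  have "lwalk (edges B) (verts B) n (fst u y) (fst v y)"
  proof (rule lwalk_map[OF assms(1)])
    fix u v assume "(u, v) \<in> edges W"
    then show "(fst u y, fst v y) \<in> (edges B)\<^sup>="
      using assms(2) by (cases u; cases v; cases "y = snd u") (auto simp: edge_W)
  qed (use lamp_W assms(2) in blast)
  then show ?thesis by (rule gdist_le[OF _ order.refl])
qed

text \<open>A lamp changes only while the walker stands at it, so the walk has visited
  \<open>y\<close>.\<close>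

lemma gdist_switched_le:
  assumes "lwalk (edges W) (verts W) n u v" "y \<in> verts A" "fst u y \<noteq> fst v y"
  shows "gdist A (snd u) y \<le> n"
  using assms(1,3)
proof (induction rule: lwalk.induct)
  case (step n u v w)
  show ?case
  proof (cases "fst u y = fst v y")
    case True
    then have "snd v = y"
      using step.hyps(2) step.prems assms(2) by (cases v; cases w) (auto simp: edge_W)
    then show ?thesis using gdist_snd_le[OF step.hyps(1)] by simp
  next
    case False
    then show ?thesis using step.IH by simp
  qed
qed simp

text \<open>
  A state whose lamp at \<open>y\<close> shows \<open>w\<close> is assumed to be safe, and likewise for \<open>y'\<close>, \<open>w'\<close>. Once one
  of the two lamps is frozen in its safe position, every walk can be replayed; so the walk \<open>Z\<close>
  between the two escape points is replayed with \<open>y\<close> frozen, then backwards with both lamps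
  frozen, then with \<open>y'\<close> frozen.
\<close>

lemma lwalk_detour:
  assumes S: "S \<subseteq> verts W" "{s \<in> verts W. fst s y = w} \<subseteq> S" "{s \<in> verts W. fst s y' = w'} \<subseteq> S"
    and y: "y \<in> verts A" "w \<in> verts B" "y' \<in> verts A" "w' \<in> verts B"
    and neq: "y = y' \<Longrightarrow> w = w'"
    and esc: "lwalk (edges W) S L u u'" "fst u' y = w" "lwalk (edges W) S L v v'" "fst v' y' = w'"
    and uv: "lwalk (edges W) (verts W) n u v"
  shows "lwalk (edges W) S (8 * L + 3 * n) u v"
proof -
  \<comment> \<open>From \<open>u'\<close> back to \<open>u\<close>, on to \<open>v\<close> and on
    to \<open>v'\<close>. Two escapes and three replays give
    \<open>L + 3 * (L + n + L) + L = 8 * L + 3 * n\<close>.\<close>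
  let ?Z = "L + n + L"
  have "lwalk (edges W) (verts W) L u' u" "lwalk (edges W) (verts W) L v v'"
    using lwalk_mono[OF _ order.refl S(1)] lwalk_sym[OF _ W.sym_edges] esc(1,3) by blast+
  then have Z: "lwalk (edges W) (verts W) ?Z u' v'"
    using lwalk_trans[OF lwalk_trans[OF _ uv]] by blast
  have 1: "lwalk (edges W) S ?Z u' (set_lamp y w v')"
    using lwalk_mono[OF lwalk_set_lamp[OF Z y(1,2)] order.refl S(2)]
    by (simp add: set_lamp_triv[OF esc(2)])
  have "lwalk (edges W) S (3 * ?Z) u' v'"
  proof (cases "y = y'")
    \<comment> \<open>Here \<open>w = w'\<close>, so freezing \<open>y\<close> leaves
      \<open>v'\<close> unchanged and one replay suffices.\<close>
    case True
    then show ?thesis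
      using lwalk_mono[OF 1 _ order.refl, of "3 * ?Z"] neq set_lamp_triv[OF esc(4)] by simp
  next
    case False
    have 2: "lwalk (edges W) {s \<in> verts W. fst s y' = w'} ?Z (set_lamp y' w' u') v'"
      using lwalk_set_lamp[OF Z y(3,4)] by (simp add: set_lamp_triv[OF esc(4)])
    \<comment> \<open>Freezing \<open>y\<close> as well in the replay \<open>2\<close> gives a walk
      which, traversed backwards, links the end of \<open>1\<close> to the start of
      \<open>2\<close>.\<close>
    have "lwalk (edges W) {s \<in> verts W. fst s y = w} ?Z (set_lamp y w (set_lamp y' w' u')) (set_lamp y w v')"
      by (rule lwalk_set_lamp[OF lwalk_mono[OF 2 order.refl] y(1,2)]) auto
    moreover have "set_lamp y w (set_lamp y' w' u') = set_lamp y' w' u'"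
      using set_lamp_commute[OF False] set_lamp_triv[OF esc(2)] by simp
    ultimately have "lwalk (edges W) S ?Z (set_lamp y w v') (set_lamp y' w' u')"
      using lwalk_mono[OF lwalk_sym[OF _ W.sym_edges] order.refl S(2)] by simp
    from lwalk_trans[OF lwalk_trans[OF 1 this] lwalk_mono[OF 2 order.refl S(3)]]
    show ?thesis by (rule lwalk_mono) simp_all
  qed
  from lwalk_trans[OF lwalk_trans[OF esc(1) this] lwalk_sym[OF esc(3) W.sym_edges]]
  show ?thesis by (rule lwalk_mono) simp_all
qed

section \<open>Escaping to a safe lamp\<close>

text \<open>Distance at least \<open>r / 4 - 1\<close> from \<open>c\<close>, written without
  division; the slack absorbs the rounding in \<open>r div 4\<close> and one extra step of the
  walker.\<close>

abbreviation far :: "('a \<Rightarrow> 'b) \<times> 'a \<Rightarrow> nat \<Rightarrow> (('a \<Rightarrow> 'b) \<times> 'a) set" where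
  "far c r \<equiv> {s \<in> verts W. r \<le> 4 * gdist W c s + 4}"

text \<open>The walker goes to a \<open>y\<close> at distance at least \<open>r div 4\<close> from
  \<open>snd c\<close> and sets the lamp there to a neighbour of its state in \<open>c\<close>; by
  \<open>gdist_switched_le\<close> this lamp certifies the distance. The target depends only on
  \<open>c\<close> and \<open>y\<close>, so two escapes to the same lamp agree on it.\<close>

lemma escape_along_base:
  assumes A: "locally_finite_graph A" "infinite (verts A)"
    and m: "\<And>b. b \<in> verts B \<Longrightarrow> (b, m b) \<in> edges B"
    and cu: "c \<in> verts W" "u \<in> verts W" "r \<le> gdist W c u" "gdist W c u \<le> R"
  obtains y u' where "y \<in> verts A" "{s \<in> verts W. fst s y = m (fst c y)} \<subseteq> far c r"
    "lwalk (edges W) (far c r) (2 * R + 1) u u'" "fst u' y = m (fst c y)"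
proof -
  obtain f x where u: "u = (f, x)" by (cases u)
  have x: "x \<in> verts A" "snd c \<in> verts A" using cu snd_W u by auto
  define D where "D = r div 4"
  have D: "r \<le> 4 * D + 3" "2 * D \<le> R" "4 * D \<le> r" using cu(3,4) by (auto simp: D_def)
  have "\<exists>y\<in>verts A. D \<le> gdist A (snd c) y \<and> lwalk (edges W) (far c r) (2 * D) (f, x) (f, y)"
  proof (cases "D \<le> gdist A (snd c) x")
    case True
    have "(f, x) \<in> far c r" using cu u by simp
    then have "lwalk (edges W) (far c r) (2 * D) (f, x) (f, x)"
      by (rule lwalk_mono[OF lwalk.refl le0 order.refl])
    then show ?thesis using True x by blast
  next
    case False
    \<comment> \<open>A vertex of the sphere of radius \<open>D\<close> is within
      \<open>2 * D\<close> of \<open>x\<close>, and the walk to it stays at distance at least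
      \<open>r - 2 * D \<ge> r / 2\<close> from \<open>c\<close>.\<close>
    obtain y where y: "y \<in> verts A" "gdist A (snd c) y = D"
      using A.sphere_nonempty[OF A x(2)] .
    have "gdist A x y \<le> 2 * D"
      using A.gdist_triangle[OF x(1,2) y(1)] A.gdist_commute[OF x] y(2) False by simp
    then have "lwalk (edges A) (verts A) (2 * D) x y"
      by (rule lwalk_mono[OF A.lwalk_gdist[OF x(1) y(1)] _ order.refl])
    then have "lwalk (edges W) (verts W) (2 * D) (f, x) (f, y)"
      using lwalk_move cu(2) u by blast
    from W.lwalk_away[OF this cu(1)] have
      "lwalk (edges W) {s \<in> verts W. r \<le> gdist W c s + 2 * D} (2 * D) (f, x) (f, y)"
      using cu(3) u by simp
    moreover have "{s \<in> verts W. r \<le> gdist W c s + 2 * D} \<subseteq> far c r"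
      using D by auto
    ultimately have "lwalk (edges W) (far c r) (2 * D) (f, x) (f, y)"
      by (rule lwalk_mono[OF _ order.refl])
    then show ?thesis using y by auto
  qed
  then obtain y where y: "y \<in> verts A" "D \<le> gdist A (snd c) y"
    and 1: "lwalk (edges W) (far c r) (2 * D) (f, x) (f, y)" by blast
  have fy: "(f, y) \<in> verts W" using move_W cu(2) u y(1) by blast
  let ?w = "m (fst c y)"
  have b: "fst c y \<in> verts B" "f y \<in> verts B" using lamp_W[OF cu(1) y(1)] lamp_W[OF fy y(1)] by auto
  have w: "(fst c y, ?w) \<in> edges B" "?w \<in> verts B"
    using m[OF b(1)] B.edges_verts by blast+
  \<comment> \<open>Undoing the difference between the lamps of \<open>u\<close> and
    \<open>c\<close> takes at most \<open>R\<close> steps, and moving on to the neighbour one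
    more.\<close>
  have "gdist B (fst c y) (f y) \<le> R"
    using gdist_lamp_le[OF W.lwalk_gdist[OF cu(1,2)] y(1)] cu(4) u by simp
  then have "gdist B (f y) ?w \<le> R + 1"
    using B.gdist_triangle[OF b(2,1) w(2)] B.gdist_edge[OF w(1)] B.gdist_commute[OF b] by simp
  then have "lwalk (edges B) (verts B) (R + 1) (f y) ?w"
    by (rule lwalk_mono[OF B.lwalk_gdist[OF b(2) w(2)] _ order.refl])
  from lwalk_lamp[OF fy this]
  have 2: "lwalk (edges W) {s \<in> verts W. snd s = y} (R + 1) (f, y) (f(y := ?w), y)" .
  \<comment> \<open>During the switching, the position of the walker alone guarantees the
    distance.\<close>
  have "{s \<in> verts W. snd s = y} \<subseteq> far c r"
  proof safe
    fix s assume s: "s \<in> verts W" "y = snd s"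
    show "r \<le> 4 * gdist W c s + 4"
      using gdist_snd_le[OF W.lwalk_gdist[OF cu(1) s(1)]] y(2) s(2) D(1) by simp
  qed
  from lwalk_trans[OF 1 lwalk_mono[OF 2 order.refl this]]
  have "lwalk (edges W) (far c r) (2 * R + 1) u (f(y := ?w), y)"
    unfolding u by (rule lwalk_mono) (use D(2) in simp_all)
  moreover have "{s \<in> verts W. fst s y = ?w} \<subseteq> far c r"
  proof safe
    fix s assume s: "s \<in> verts W" "fst s y = ?w"
    have "fst c y \<noteq> fst s y" using B.edge_neq[OF w(1)] s(2) by simp
    from gdist_switched_le[OF W.lwalk_gdist[OF cu(1) s(1)] y(1) this]
    show "r \<le> 4 * gdist W c s + 4" using y(2) D(1) by simp
  qed
  ultimately show thesis using that[of y] y(1) by simp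
qed

text \<open>The lamp is driven to distance at least \<open>r div 4\<close> from its state in
  \<open>c\<close>, by a walk of length at most \<open>2 * (r div 4) + 1\<close>, too short to come
  near \<open>c\<close>. Allowing \<open>y\<close> next to the walker lets two escapes use different
  lamps.\<close>

lemma escape_along_fibre:
  assumes B: "locally_finite_graph B" "infinite (verts B)"
    and cu: "c \<in> verts W" "u \<in> verts W" "r \<le> gdist W c u" "gdist W c u \<le> R"
    and y: "y \<in> verts A" "gdist A (snd u) y \<le> 1"
  obtains w u' where "w \<in> verts B" "{s \<in> verts W. fst s y = w} \<subseteq> far c r"
    "lwalk (edges W) (far c r) (2 * R + 1) u u'" "fst u' y = w"
proof -
  obtain f x where u: "u = (f, x)" by (cases u)
  define D where "D = r div 4"
  have D: "r \<le> 4 * D + 3" "2 * D \<le> R" "4 * D \<le> r" using cu(3,4) by (auto simp: D_def)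
  have fy: "(f, y) \<in> verts W" using move_W cu(2) u y(1) by blast
  have b: "fst c y \<in> verts B" "f y \<in> verts B" using lamp_W[OF cu(1) y(1)] lamp_W[OF fy y(1)] by auto
  have "\<exists>w\<in>verts B. D \<le> gdist B (fst c y) w \<and> gdist B (f y) w \<le> 2 * D"
  proof (cases "D \<le> gdist B (fst c y) (f y)")
    case True
    then show ?thesis using b B.gdist_self by (intro bexI[of _ "f y"]) auto
  next
    case False
    obtain w where w: "w \<in> verts B" "gdist B (fst c y) w = D"
      using B.sphere_nonempty[OF B b(1)] .
    then show ?thesis
      using B.gdist_triangle[OF b(2,1) w(1)] B.gdist_commute[OF b] False
      by (intro bexI[of _ w]) auto
  qed
  then obtain w where w: "w \<in> verts B" "D \<le> gdist B (fst c y) w" "gdist B (f y) w \<le> 2 * D" by blast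
  have "lwalk (edges A) (verts A) 1 x y"
    using lwalk_mono[OF A.lwalk_gdist[OF snd_W[OF cu(2)] y(1)] y(2) order.refl] u by simp
  then have 1: "lwalk (edges W) (verts W) 1 (f, x) (f, y)" using lwalk_move cu(2) u by blast
  have "lwalk (edges B) (verts B) (2 * D) (f y) w"
    by (rule lwalk_mono[OF B.lwalk_gdist[OF b(2) w(1)] w(3) order.refl])
  then have "lwalk (edges W) (verts W) (2 * D) (f, y) (f(y := w), y)"
    by (rule lwalk_mono[OF lwalk_lamp[OF fy] order.refl]) blast
  from lwalk_trans[OF 1 this] have "lwalk (edges W) (verts W) (1 + 2 * D) u (f(y := w), y)"
    using u by simp
  from W.lwalk_away[OF this cu(1,3)]
  have "lwalk (edges W) {s \<in> verts W. r \<le> gdist W c s + (1 + 2 * D)} (1 + 2 * D) u (f(y := w), y)" .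
  moreover have "1 + 2 * D \<le> 2 * R + 1" using D(2) by simp
  moreover have "{s \<in> verts W. r \<le> gdist W c s + (1 + 2 * D)} \<subseteq> far c r"
    using D by auto
  ultimately have "lwalk (edges W) (far c r) (2 * R + 1) u (f(y := w), y)"
    by (rule lwalk_mono)
  moreover have "{s \<in> verts W. fst s y = w} \<subseteq> far c r"
  proof safe
    fix s assume s: "s \<in> verts W" "w = fst s y"
    show "r \<le> 4 * gdist W c s + 4"
      using gdist_lamp_le[OF W.lwalk_gdist[OF cu(1) s(1)] y(1)] w(2) s(2) D(1) by simp
  qed
  ultimately show thesis using that[OF w(1)] by simp
qed

section \<open>From detours to linear divergence\<close>

text \<open>The hypothesis is invoked only with \<open>R = 3 * n\<close>, where it yields length
  \<open>51 * n + 8\<close>; hence the constant 51.\<close>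

lemma linear_divergence_if_detours:
  assumes "\<And>c u v r R n. \<lbrakk>c \<in> verts W; u \<in> verts W; v \<in> verts W; r \<le> gdist W c u; r \<le> gdist W c v;
      gdist W c u \<le> R; gdist W c v \<le> R; gdist W u v \<le> n\<rbrakk>
    \<Longrightarrow> lwalk (edges W) (far c r) (8 * (2 * R + 1) + 3 * n) u v"
  shows "linear_divergence (realization W)"
proof (rule W.linear_divergence_if_lwalks[of 51])
  fix c u v r n
  assume V: "c \<in> verts W" "u \<in> verts W" "v \<in> verts W"
    and le: "r \<le> gdist W c u" "r \<le> gdist W c v" "gdist W u v \<le> n"
  let ?S = "{w \<in> verts W. r \<le> 4 * gdist W c w + 51}"
  define \<rho> where "\<rho> = min (gdist W c u) (gdist W c v)"
  show "lwalk (edges W) ?S (51 * n + 51) u v"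
  proof (cases "2 * n \<le> \<rho>")
    \<comment> \<open>A geodesic of length at most \<open>n \<le> \<rho> / 2\<close> stays at
      distance at least \<open>\<rho> / 2\<close> from \<open>c\<close>.\<close>
    case True
    have "lwalk (edges W) (verts W) n u v"
      by (rule lwalk_mono[OF W.lwalk_gdist[OF V(2,3)] le(3) order.refl])
    then have "lwalk (edges W) {w \<in> verts W. \<rho> \<le> gdist W c w + n} n u v"
      by (rule W.lwalk_away) (use V \<rho>_def in simp_all)
    moreover have "n \<le> 51 * n + 51" by simp
    moreover have "{w \<in> verts W. \<rho> \<le> gdist W c w + n} \<subseteq> ?S"
    proof safe
      fix w assume "\<rho> \<le> gdist W c w + n"
      then show "r \<le> 4 * gdist W c w + 51" using True le \<rho>_def by linarith
    qed
    ultimately show ?thesis by (rule lwalk_mono)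
  next
    case False
    have "gdist W c u \<le> gdist W c v + n" "gdist W c v \<le> gdist W c u + n"
      using W.gdist_triangle[OF V(1,3,2)] W.gdist_triangle[OF V(1,2,3)] le(3)
        W.gdist_commute[OF V(2,3)] by linarith+
    \<comment> \<open>The nearer of \<open>u\<close> and \<open>v\<close> is closer than
      \<open>2 * n\<close> to \<open>c\<close>, the other at most \<open>n\<close> farther.\<close>
    then have "gdist W c u \<le> 3 * n" "gdist W c v \<le> 3 * n"
      using False \<rho>_def by linarith+
    from assms[OF V le(1,2) this le(3)]
    have "lwalk (edges W) (far c r) (8 * (2 * (3 * n) + 1) + 3 * n) u v" .
    moreover have "8 * (2 * (3 * n) + 1) + 3 * n \<le> 51 * n + 51" by simp
    moreover have "far c r \<subseteq> ?S" by auto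
    ultimately show ?thesis by (rule lwalk_mono)
  qed
qed

lemma linear_divergence_infinite_base:
  assumes "locally_finite_graph A" "infinite (verts A)"
    and "\<exists>u\<in>verts B. \<exists>v\<in>verts B. u \<noteq> v"
  shows "linear_divergence (realization W)"
proof (rule linear_divergence_if_detours)
  \<comment> \<open>One function \<open>m\<close> serves both escapes, so that for
    \<open>y = z\<close> they prescribe the same state, as \<open>lwalk_detour\<close>
    demands.\<close>
  have "\<exists>b'. b \<in> verts B \<longrightarrow> (b, b') \<in> edges B" for b
    using B.ex_neighbour[OF assms(3)] by blast
  then obtain m where m: "b \<in> verts B \<Longrightarrow> (b, m b) \<in> edges B" for b by metis
  fix c u v r R n
  assume V: "c \<in> verts W" "u \<in> verts W" "v \<in> verts W"
    and le: "r \<le> gdist W c u" "r \<le> gdist W c v" "gdist W c u \<le> R" "gdist W c v \<le> R" "gdist W u v \<le> n"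
  obtain y u' where y: "y \<in> verts A" "{s \<in> verts W. fst s y = m (fst c y)} \<subseteq> far c r"
    "lwalk (edges W) (far c r) (2 * R + 1) u u'" "fst u' y = m (fst c y)"
    by (rule escape_along_base[OF assms(1,2) m V(1,2) le(1,3)])
  obtain z v' where z: "z \<in> verts A" "{s \<in> verts W. fst s z = m (fst c z)} \<subseteq> far c r"
    "lwalk (edges W) (far c r) (2 * R + 1) v v'" "fst v' z = m (fst c z)"
    by (rule escape_along_base[OF assms(1,2) m V(1,3) le(2,4)])
  have mW: "m (fst c x) \<in> verts B" if "x \<in> verts A" for x
    using B.edges_verts[OF m[OF lamp_W[OF V(1) that]]] by blast
  show "lwalk (edges W) (far c r) (8 * (2 * R + 1) + 3 * n) u v"
  proof (rule lwalk_detour[OF _ y(2) z(2) y(1) mW[OF y(1)] z(1) mW[OF z(1)] _ y(3,4) z(3,4)])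
    show "lwalk (edges W) (verts W) n u v"
      by (rule lwalk_mono[OF W.lwalk_gdist[OF V(2,3)] le(5) order.refl])
  qed auto
qed

lemma linear_divergence_infinite_fibre:
  assumes "locally_finite_graph B" "infinite (verts B)"
    and "\<exists>u\<in>verts A. \<exists>v\<in>verts A. u \<noteq> v"
  shows "linear_divergence (realization W)"
proof (rule linear_divergence_if_detours)
  fix c u v r R n
  assume V: "c \<in> verts W" "u \<in> verts W" "v \<in> verts W"
    and le: "r \<le> gdist W c u" "r \<le> gdist W c v" "gdist W c u \<le> R" "gdist W c v \<le> R" "gdist W u v \<le> n"
  obtain x where x: "(snd v, x) \<in> edges A"
    using A.ex_neighbour[OF assms(3) snd_W[OF V(3)]] .
  \<comment> \<open>The escapes may choose different target states, so they must use different
    lamps; a neighbour is taken when the walker stands at the same vertex in \<open>u\<close> and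
    \<open>v\<close>.\<close>
  define z where "z = (if snd u = snd v then x else snd v)"
  have y: "snd u \<in> verts A" "gdist A (snd u) (snd u) \<le> 1"
    using snd_W[OF V(2)] A.gdist_self by auto
  have z: "z \<in> verts A" "gdist A (snd v) z \<le> 1" "snd u \<noteq> z"
    using snd_W[OF V(3)] A.edges_verts[OF x] A.gdist_edge[OF x] A.edge_neq[OF x] A.gdist_self
    by (auto simp: z_def)
  obtain w u' where w: "w \<in> verts B" "{s \<in> verts W. fst s (snd u) = w} \<subseteq> far c r"
    "lwalk (edges W) (far c r) (2 * R + 1) u u'" "fst u' (snd u) = w"
    by (rule escape_along_fibre[OF assms(1,2) V(1,2) le(1,3) y])
  obtain w' v' where w': "w' \<in> verts B" "{s \<in> verts W. fst s z = w'} \<subseteq> far c r"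
    "lwalk (edges W) (far c r) (2 * R + 1) v v'" "fst v' z = w'"
    by (rule escape_along_fibre[OF assms(1,2) V(1,3) le(2,4) z(1,2)])
  show "lwalk (edges W) (far c r) (8 * (2 * R + 1) + 3 * n) u v"
  proof (rule lwalk_detour[OF _ w(2) w'(2) y(1) w(1) z(1) w'(1) _ w(3,4) w'(3,4)])
    show "lwalk (edges W) (verts W) n u v"
      by (rule lwalk_mono[OF W.lwalk_gdist[OF V(2,3)] le(5) order.refl])
  qed (use z(3) in auto)
qed

lemma linear_divergence_finite:
  assumes "finite (verts A)" "finite (verts B)"
  shows "linear_divergence (realization W)"
proof -
  have "verts W \<subseteq> (verts A \<rightarrow>\<^sub>E verts B) \<times> verts A" by (auto simp: mem_W)
  then have fin: "finite (verts W)"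
    using assms finite_PiE finite_subset by (metis finite_cartesian_product)
  \<comment> \<open>\<open>K\<close> bounds all distances and hence \<open>r\<close>, so the
    distance constraint is void and a shortest walk will do.\<close>
  define K where "K = Max ((\<lambda>(u, v). gdist W u v) ` (verts W \<times> verts W))"
  have K: "gdist W u v \<le> K" if "u \<in> verts W" "v \<in> verts W" for u v
    unfolding K_def using fin that by (intro Max_ge) auto
  show ?thesis
  proof (rule W.linear_divergence_if_lwalks[of K])
    fix c u v r n
    assume V: "c \<in> verts W" "u \<in> verts W" "v \<in> verts W" and "r \<le> gdist W c u"
    then have "r \<le> K" using K[of c u] by simp
    then have "verts W \<subseteq> {w \<in> verts W. r \<le> 4 * gdist W c w + K}" by auto
    moreover have "gdist W u v \<le> K * n + K" using K[OF V(2,3)] by simp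
    ultimately show "lwalk (edges W) {w \<in> verts W. r \<le> 4 * gdist W c w + K} (K * n + K) u v"
      by (intro lwalk_mono[OF W.lwalk_gdist[OF V(2,3)]])
  qed
qed

end

theorem theorem3:
  fixes A :: "'a sgraph" and B :: "'b sgraph" and b\<^sub>0 :: 'b
  assumes "simple_graph A" "connected_graph A" "vertex_transitive A" "locally_finite_graph A"
    and "\<exists>u\<in>verts A. \<exists>v\<in>verts A. u \<noteq> v"
    and "simple_graph B" "connected_graph B" "vertex_transitive B" "locally_finite_graph B"
    and "\<exists>u\<in>verts B. \<exists>v\<in>verts B. u \<noteq> v"
    and "b\<^sub>0 \<in> verts B"
  shows "linear_divergence (realization (wreath B b\<^sub>0 A))"
proof -
  interpret wreath_graphs A B b\<^sub>0
    using assms by unfold_locales auto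
  show ?thesis
    using linear_divergence_finite linear_divergence_infinite_base[OF assms(4) _ assms(10)]
      linear_divergence_infinite_fibre[OF assms(9) _ assms(5)] by blast
qed

end
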